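(* Let $s>0$ and let $X=(X,d)$ be a complete separable metric space which is $s$-regular. Let $A\subset X$. Then $A$ is uniformly $\varrho$-porous for some $\varrho>0$ if and only if there exist $t$ with $0<t<s$ and a $t$-regular set $F\subset X$ with $F\supset A$.
   Context: $B(x,r)$ denotes the ball in $X$ with centre $x$ and radius $r$ (the paper does not specify whether open or closed). Regularity: for $u>0$, a measure $\mu$ on $X$ is called $u$-regular on a set $E\subset X$ if there are constants $0<a_\mu\le b_\mu<\infty$ and $r_\mu>0$ such that $a_\mu r^u\le \mu(B(x,r))\le b_\mu r^u$ for every $x\in E$ and $0<r<r_\mu$. A set $E\subset X$ is called $u$-regular if there is a measure $\mu$ on $X$ which is $u$-regular on $E$ and satisfies $\mu(X\setminus E)=0$. In particular, $X$ is $s$-regular if there is a measure on $X$ that is $s$-regular on $X$. Porosity: for $A\subset X$, $x\in X$ and $r>0$ put $$\operatorname{por}(A,x,r)=\sup\{\varrho\ge 0 : B(y,\varrho r)\subset B(x,r)\setminus A \text{ for some } y\in X\}.$$ The set $A$ is called uniformly (lower) $\varrho$-porous if there is a constant $r_p>0$ such that $\operatorname{por}(A,x,r)>\varrho$ for all $x\in A$ and $0<r<r_p$. *)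

theory Defs
  imports "HOL-Analysis.Analysis"
begin

text \<open>
  Conventions: \<open>B(x,r)\<close> is the open ball, and a measure on \<open>X\<close> is a measure on the Borel sets.
\<close>

definition regular_on :: "real \<Rightarrow> 'a::metric_space measure \<Rightarrow> 'a set \<Rightarrow> bool" where
  "regular_on u \<mu> E \<longleftrightarrow>
     (\<exists>a b R. 0 < a \<and> a \<le> b \<and> 0 < R \<and>
       (\<forall>x\<in>E. \<forall>r. 0 < r \<and> r < R \<longrightarrow>
          ennreal (a * r powr u) \<le> emeasure \<mu> (ball x r) \<and>
          emeasure \<mu> (ball x r) \<le> ennreal (b * r powr u)))"

text \<open>
  The set \<open>E\<close> is not assumed to be Borel, so that \<open>\<mu>(X \<setminus> E) = 0\<close> is expressed by
  the outer measure generated by \<open>\<mu>\<close>; it agrees with \<open>\<mu>\<close> on Borel sets.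
\<close>

definition regular_set :: "real \<Rightarrow> 'a::metric_space set \<Rightarrow> bool" where
  "regular_set u E \<longleftrightarrow>
     (\<exists>\<mu>. sets \<mu> = sets borel \<and> regular_on u \<mu> E \<and> outer_measure_of \<mu> (UNIV - E) = 0)"

text \<open>
  The supremum is taken in the extended reals since the set can be unbounded when \<open>x \<notin> A\<close>.
  It is nonempty because \<open>B(y,0)\<close> is empty.
\<close>

definition por :: "'a::metric_space set \<Rightarrow> 'a \<Rightarrow> real \<Rightarrow> ereal" where
  "por A x r = (SUP \<rho>\<in>{\<rho>. 0 \<le> \<rho> \<and> (\<exists>y. ball y (\<rho> * r) \<subseteq> ball x r - A)}. ereal \<rho>)"

definition uniformly_porous :: "real \<Rightarrow> 'a::metric_space set \<Rightarrow> bool" where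
  "uniformly_porous \<rho> A \<longleftrightarrow>
     (\<exists>R>0. \<forall>x\<in>A. \<forall>r. 0 < r \<and> r < R \<longrightarrow> por A x r > ereal \<rho>)"

end

theory Submission
  imports Defs
begin

text \<open>
  \<^bold>\<open>From a regular superset to pores.\<close> In an \<open>s\<close>-regular space a ball of radius \<open>r\<close> contains
  about \<open>\<epsilon> powr (- s)\<close> points at mutual distance \<open>\<epsilon> * r\<close>. If the small balls about all of them met
  a \<open>t\<close>-regular set, the measure of that set would be split into as many disjoint pieces of size
  about \<open>(\<epsilon> * r) powr t\<close>, and there is only room for about \<open>\<epsilon> powr (- t)\<close> of these
  (\<open>porous_if_regular_superset\<close>). As \<open>t < s\<close>, this fails for small \<open>\<epsilon>\<close>, and a ball that is
  missed is a pore.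

  \<^bold>\<open>From pores to a regular superset.\<close> Let \<open>A\<close> have, in each ball \<open>B(x, \<delta>)\<close> about one of its
  points, a pore of radius \<open>2 * \<eta> * \<delta>\<close>. The halved pores are disjoint from the \<open>\<eta> * \<delta>\<close>-neighbourhood
  of \<open>A\<close> and make up a fixed proportion of its \<open>\<delta>\<close>-neighbourhood, so that passing from \<open>\<delta>\<close> to
  \<open>\<eta> * \<delta>\<close> multiplies the measure by at most \<open>decay \<eta> < 1\<close> (\<open>neighbourhood_decay\<close>). Hence \<open>A\<close>
  contains fewer separated points than the space does (\<open>card_separated_porous_le\<close>): when the
  separation shrinks by the factor \<open>\<eta>\<close>, the bound on their number grows by the factor
  \<open>decay \<eta> * \<eta> powr (- s)\<close> only. Choose \<open>t < s\<close> so close to \<open>s\<close> that \<open>decay \<eta> * \<eta> powr (- s) * \<eta> powr t < 1\<close>.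

  The set \<open>A\<close> itself may be far too small to carry a \<open>t\<close>-regular measure; the missing mass is put
  into its pores. For every \<open>k\<close> take a maximal \<open>\<eta> ^ k * r0\<close>-separated subset of \<open>A\<close>, and in the
  pore at each of its points place a Cantor set carrying a \<open>t\<close>-regular measure of total mass
  \<open>(\<eta> ^ Suc k * r0) powr t\<close> (\<open>exists_regular_piece\<close>). Let \<open>\<nu>\<close> be the sum of all these measures
  (locale \<open>pore_filling\<close>). In a ball of radius \<open>\<delta>\<close>,

  \<^item> pieces of scale at most \<open>\<delta>\<close> have total mass at most a geometric series with ratio
    \<open>decay \<eta> * \<eta> powr (- s) * \<eta> powr t\<close>, by the bound on the number of separated points;

  \<^item> pieces of larger scale lie at distance comparable to their scale from \<open>A\<close>, so that only
    boundedly many of them are close to a given point, and each contributes at most a multiple of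
    \<open>\<delta> powr t\<close>.

  This is the upper bound (\<open>\<nu>_ball_le\<close>). The lower bound (\<open>\<nu>_ball_ge\<close>) holds because every ball
  about a point of \<open>A\<close> contains an entire piece of comparable scale, while at a point of a piece the
  piece itself suffices at small radii. Both bounds survive passing to the closure of the union of
  \<open>A\<close> and the pieces, and \<open>\<nu>\<close> vanishes off this closure.
\<close>

section \<open>Ahlfors regular spaces and packing\<close>

lemma geometric_scale:
  fixes \<kappa> c \<delta> :: real
  assumes \<kappa>: "0 < \<kappa>" "\<kappa> < 1" and \<delta>: "0 < \<delta>" "\<delta> < c"
  obtains k where "\<kappa> ^ Suc k * c \<le> \<delta>" and "\<delta> < \<kappa> ^ k * c"
proof -
  have c: "0 < c" using \<delta> by simp
  obtain n where "\<kappa> ^ n < \<delta> / c"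
    using real_arch_pow_inv[of "\<delta> / c" \<kappa>] \<kappa> \<delta> c by auto
  then have n: "\<kappa> ^ n * c \<le> \<delta>" using c by (simp add: field_simps)
  have "\<not> \<kappa> ^ 0 * c \<le> \<delta>" using \<delta> by simp
  with n obtain k where "k < n" "\<forall>i\<le>k. \<not> \<kappa> ^ i * c \<le> \<delta>" "\<kappa> ^ Suc k * c \<le> \<delta>"
    using ex_least_nat_less[of "\<lambda>n. \<kappa> ^ n * c \<le> \<delta>" n] by blast
  then show ?thesis using that[of k] by (simp add: not_le)
qed

locale regular_space =
  fixes \<mu> :: "'a::polish_space measure" and s a b R :: real
  assumes s_pos: "0 < s" and a_pos: "0 < a" and a_le_b: "a \<le> b" and R_pos: "0 < R"
    and sets_\<mu>: "sets \<mu> = sets borel"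
    and lower: "\<And>x r. 0 < r \<Longrightarrow> r < R \<Longrightarrow> ennreal (a * r powr s) \<le> emeasure \<mu> (ball x r)"
    and upper: "\<And>x r. 0 < r \<Longrightarrow> r < R \<Longrightarrow> emeasure \<mu> (ball x r) \<le> ennreal (b * r powr s)"
begin

lemma b_pos: "0 < b" using a_pos a_le_b by simp

text \<open>
  The points are chosen greedily: as long as fewer than \<open>N\<close> of them are there, the balls of radius
  \<open>\<epsilon> * r\<close> about them have too little measure to cover \<open>ball x r\<close>.
\<close>

lemma separated_points:
  assumes r: "0 < r" "r < R" and \<epsilon>: "0 < \<epsilon>" "\<epsilon> < 1" and N: "real N * (b * \<epsilon> powr s) \<le> a"
  obtains f :: "nat \<Rightarrow> 'a" where "\<And>i. i < N \<Longrightarrow> f i \<in> ball x r"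
    and "\<And>i j. i < N \<Longrightarrow> j < N \<Longrightarrow> i \<noteq> j \<Longrightarrow> \<epsilon> * r \<le> dist (f i) (f j)"
proof -
  have "\<exists>f. (\<forall>i<n. f i \<in> ball x r) \<and> (\<forall>i<n. \<forall>j<n. i \<noteq> j \<longrightarrow> \<epsilon> * r \<le> dist (f i) (f j))"
    if "n \<le> N" for n
    using that
  proof (induction n)
    case 0
    show ?case by simp
  next
    case (Suc n)
    then obtain f where f: "\<And>i. i < n \<Longrightarrow> f i \<in> ball x r"
      and sep: "\<And>i j. i < n \<Longrightarrow> j < n \<Longrightarrow> i \<noteq> j \<Longrightarrow> \<epsilon> * r \<le> dist (f i) (f j)"
      by auto
    have \<epsilon>r: "0 < \<epsilon> * r" "\<epsilon> * r < R"
      using r \<epsilon> mult_strict_right_mono[of \<epsilon> 1 r] by (simp, linarith)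
    have "\<not> ball x r \<subseteq> (\<Union>i<n. ball (f i) (\<epsilon> * r))"
    proof
      assume sub: "ball x r \<subseteq> (\<Union>i<n. ball (f i) (\<epsilon> * r))"
      have "ennreal (a * r powr s) \<le> emeasure \<mu> (ball x r)"
        by (rule lower[OF r])
      also have "\<dots> \<le> emeasure \<mu> (\<Union>i<n. ball (f i) (\<epsilon> * r))"
        by (rule emeasure_mono[OF sub]) (auto simp: sets_\<mu>)
      also have "\<dots> \<le> (\<Sum>i<n. emeasure \<mu> (ball (f i) (\<epsilon> * r)))"
        by (rule emeasure_subadditive_finite) (auto simp: sets_\<mu>)
      also have "\<dots> \<le> (\<Sum>i<n. ennreal (b * (\<epsilon> * r) powr s))"
        by (intro sum_mono upper \<epsilon>r)
      also have "\<dots> = ennreal (real n * (b * (\<epsilon> * r) powr s))"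
        using b_pos by (simp add: ennreal_mult ennreal_of_nat_eq_real_of_nat)
      finally have "a * r powr s \<le> real n * (b * (\<epsilon> * r) powr s)"
        using b_pos by (subst (asm) ennreal_le_iff) auto
      also have "\<dots> < real N * (b * (\<epsilon> * r) powr s)"
        using Suc.prems b_pos \<epsilon>r by (intro mult_strict_right_mono mult_pos_pos) auto
      also have "\<dots> = (real N * (b * \<epsilon> powr s)) * r powr s"
        using r \<epsilon> by (simp add: powr_mult)
      also have "\<dots> \<le> a * r powr s"
        using N by (intro mult_right_mono) auto
      finally show False by simp
    qed
    then obtain z where z: "z \<in> ball x r" "\<And>i. i < n \<Longrightarrow> \<epsilon> * r \<le> dist (f i) z"
      by (auto simp: subset_eq not_less)
    show ?case
      by (intro exI[of _ "f(n := z)"])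
        (auto simp: less_Suc_eq f z sep dist_commute[of z] simp del: mem_ball)
  qed
  from this[OF order_refl] show ?thesis using that by blast
qed

end

section \<open>Regular measures on Cantor sets\<close>

text \<open>
  A tree of points in which every node has \<open>N\<close> children and the scale \<open>\<kappa> ^ k * r\<close> of generation \<open>k\<close>
  governs the distances. The relation \<open>N * \<kappa> powr t = 1\<close> makes \<open>t\<close> the dimension of the limit
  set, and a separation of four times the scale of the children keeps the subtrees apart, since
  the limit points below a node stay within two thirds of its scale.
\<close>

locale cantor_scheme =
  fixes N :: nat and \<kappa> t r :: real and root :: "'a::polish_space"
    and child :: "nat \<Rightarrow> 'a \<Rightarrow> nat \<Rightarrow> 'a"
  assumes \<kappa>: "0 < \<kappa>" "\<kappa> \<le> 1/4" and t_pos: "0 < t" and r_pos: "0 < r"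
    and N_eq: "real N * \<kappa> powr t = 1"
    and child_near: "\<And>k c i. i < N \<Longrightarrow> dist c (child k c i) < \<kappa> ^ k * r / 2"
    and child_sep: "\<And>k c i j. i < N \<Longrightarrow> j < N \<Longrightarrow> i \<noteq> j \<Longrightarrow>
           4 * (\<kappa> ^ Suc k * r) \<le> dist (child k c i) (child k c j)"
begin

lemma N_pos: "0 < N"
  using N_eq by (cases N) auto

text \<open>
  Nodes of generation \<open>k\<close> are numbered by \<open>j < N ^ k\<close>; the last base-\<open>N\<close> digit of \<open>j\<close> says which
  child of its parent a node is. With this numbering the branch belonging to \<open>u \<in> {0..<1}\<close> runs
  through the nodes \<open>\<lfloor>N ^ k * u\<rfloor>\<close>, and the uniform measure on branches is Lebesgue measure.
\<close>

primrec node :: "nat \<Rightarrow> nat \<Rightarrow> 'a" where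
  "node 0 j = root"
| "node (Suc k) j = child k (node k (j div N)) (j mod N)"

definition digits :: "nat \<Rightarrow> real \<Rightarrow> nat" where
  "digits k u = nat \<lfloor>real N ^ k * u\<rfloor>"

definition centre :: "nat \<Rightarrow> real \<Rightarrow> 'a" where
  "centre k u = node k (digits k u)"

definition point :: "real \<Rightarrow> 'a" where
  "point u = lim (\<lambda>k. centre k u)"

lemma digits_Suc_div: "digits (Suc k) u div N = digits k u"
proof -
  have "\<lfloor>real N ^ Suc k * u\<rfloor> div int N = \<lfloor>real N ^ Suc k * u / real_of_int (int N)\<rfloor>"
    by (simp only: floor_divide_real_eq_div of_nat_0_le_iff)
  also have "real N ^ Suc k * u / real_of_int (int N) = real N ^ k * u"
    using N_pos by simp
  finally have *: "\<lfloor>real N ^ Suc k * u\<rfloor> div int N = \<lfloor>real N ^ k * u\<rfloor>" .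
  show ?thesis
  proof (cases "u \<ge> 0")
    case True
    then have "0 \<le> \<lfloor>real N ^ Suc k * u\<rfloor>" by simp
    then show ?thesis
      unfolding digits_def *[symmetric] by (simp add: nat_div_distrib)
  next
    case False
    then have "real N ^ k * u \<le> 0" for k
      by (simp add: mult_nonneg_nonpos)
    then have "\<lfloor>real N ^ k * u\<rfloor> \<le> 0" for k
      by (metis floor_mono floor_zero)
    then have "digits k u = 0" for k
      unfolding digits_def by (meson nat_0_iff)
    then show ?thesis by simp
  qed
qed

lemma centre_Suc: "centre (Suc k) u = child k (centre k u) (digits (Suc k) u mod N)"
  by (simp add: centre_def digits_Suc_div)

lemma centre_step: "dist (centre k u) (centre (Suc k) u) < \<kappa> ^ k * r / 2"
  unfolding centre_Suc by (rule child_near) (simp add: N_pos)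

text \<open>
  The term \<open>2/3 * (\<kappa> ^ (k + n) * r)\<close> on the left is what the remaining steps may still use up. It
  makes the geometric series telescope in the induction: a step costs one half of the scale, and
  \<open>1/2 + 2/3 * \<kappa> \<le> 2/3\<close> as \<open>\<kappa> \<le> 1/4\<close>.
\<close>

lemma centre_dist: "dist (centre k u) (centre (k + n) u) + 2/3 * (\<kappa> ^ (k + n) * r) \<le> 2/3 * (\<kappa> ^ k * r)"
proof (induction n)
  case (Suc n)
  have "dist (centre k u) (centre (k + Suc n) u) \<le>
      dist (centre k u) (centre (k + n) u) + dist (centre (k + n) u) (centre (Suc (k + n)) u)"
    by (simp add: dist_triangle)
  moreover have "\<kappa> ^ (k + Suc n) * r \<le> 1/4 * (\<kappa> ^ (k + n) * r)"
    using \<kappa> r_pos by (simp add: mult_right_mono)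
  ultimately show ?case using Suc centre_step[of "k+n" u] by linarith
qed auto

lemma tail_small: "(\<lambda>k. \<kappa> ^ k * r) \<longlonglongrightarrow> 0"
  using LIMSEQ_realpow_zero[of \<kappa>] \<kappa> by (intro tendsto_mult_left_zero) auto

lemma centre_tendsto: "(\<lambda>k. centre k u) \<longlonglongrightarrow> point u"
proof -
  have "Cauchy (\<lambda>k. centre k u)"
    unfolding Cauchy_altdef2
  proof (intro allI impI)
    fix e :: real assume "e > 0"
    then obtain k where k: "\<kappa> ^ k * r < e"
      using order_tendstoD(2)[OF tail_small] by (meson eventually_sequentially order_refl)
    have "dist (centre n u) (centre k u) < e" if "n \<ge> k" for n
    proof -
      have "0 < \<kappa> ^ k * r" "0 < \<kappa> ^ n * r" using \<kappa> r_pos by auto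
      moreover have "k + (n - k) = n" using that by simp
      ultimately show ?thesis
        using centre_dist[of k u "n - k"] k dist_commute[of "centre n u" "centre k u"] by (simp only:)
    qed
    then show "\<exists>k. \<forall>n\<ge>k. dist (centre n u) (centre k u) < e" by blast
  qed
  then show ?thesis
    unfolding point_def by (simp add: Cauchy_convergent_iff convergent_LIMSEQ_iff)
qed

lemma centre_point: "dist (centre k u) (point u) \<le> 2/3 * (\<kappa> ^ k * r)"
proof (rule LIMSEQ_le_const2)
  show "(\<lambda>n. dist (centre k u) (centre n u)) \<longlonglongrightarrow> dist (centre k u) (point u)"
    by (intro tendsto_intros centre_tendsto)
  have "dist (centre k u) (centre n u) \<le> 2/3 * (\<kappa> ^ k * r)" if "n \<ge> k" for n
  proof -
    have "0 < \<kappa> ^ n * r" using \<kappa> r_pos by auto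
    moreover have "k + (n - k) = n" using that by simp
    ultimately show ?thesis using centre_dist[of k u "n - k"] by (simp only:)
  qed
  then show "\<exists>M. \<forall>n\<ge>M. dist (centre k u) (centre n u) \<le> 2/3 * (\<kappa> ^ k * r)" by blast
qed

lemma point_near_root: "point u \<in> ball root r"
  using centre_point[of 0 u] r_pos by (simp add: centre_def)

lemma same_cell_close:
  assumes "digits k u = digits k v"
  shows "dist (point u) (point v) < 2 * (\<kappa> ^ k * r)"
proof -
  have "centre k u = centre k v" by (simp add: centre_def assms)
  then have "dist (point u) (point v) \<le> dist (centre k u) (point u) + dist (centre k v) (point v)"
    by (metis dist_triangle3)
  moreover have "0 < \<kappa> ^ k * r" using \<kappa> r_pos by auto
  ultimately show ?thesis using centre_point[of k u] centre_point[of k v] by linarith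
qed

text \<open>
  Go back to the generation in which the two branches separate: there the nodes are at least four
  scales apart, and each limit point is within two thirds of the scale from its node.
\<close>

lemma different_cell_apart:
  assumes "u \<in> {0..<1}" "v \<in> {0..<1}" "digits k u \<noteq> digits k v"
  shows "2 * (\<kappa> ^ k * r) \<le> dist (point u) (point v)"
  using assms(3)
proof (induction k)
  case 0
  then show ?case using assms by (simp add: digits_def floor_eq_iff)
next
  case (Suc k)
  have pos: "0 < \<kappa> ^ k * r" "0 < \<kappa> ^ Suc k * r" using \<kappa> r_pos by auto
  show ?case
  proof (cases "digits k u = digits k v")
    case False
    moreover have "\<kappa> ^ Suc k * r \<le> \<kappa> ^ k * r"
      using \<kappa> r_pos by (simp add: mult_le_cancel_right1 mult.assoc)
    ultimately show ?thesis using Suc.IH by linarith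
  next
    case True
    then have "centre k u = centre k v" by (simp add: centre_def)
    moreover have "digits (Suc k) u mod N \<noteq> digits (Suc k) v mod N"
      using True Suc.prems digits_Suc_div[of k u] digits_Suc_div[of k v]
      by (metis div_mult_mod_eq)
    ultimately have "4 * (\<kappa> ^ Suc k * r) \<le> dist (centre (Suc k) u) (centre (Suc k) v)"
      unfolding centre_Suc by (metis child_sep mod_less_divisor N_pos)
    also have "\<dots> \<le> dist (centre (Suc k) u) (point u) + dist (point u) (point v)
        + dist (centre (Suc k) v) (point v)"
      using dist_triangle[of "centre (Suc k) u" "centre (Suc k) v" "point u"]
        dist_triangle[of "point u" "centre (Suc k) v" "point v"]
      by (simp add: dist_commute)
    finally show ?thesis
      using centre_point[of "Suc k" u] centre_point[of "Suc k" v] pos by linarith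
  qed
qed

lemma point_measurable [measurable]: "point \<in> borel_measurable borel"
proof (rule borel_measurable_LIMSEQ_metric[where f = centre])
  fix k
  have "digits k \<in> measurable borel (count_space UNIV)"
    unfolding digits_def by measurable
  then show "centre k \<in> borel_measurable borel"
    unfolding centre_def by (rule measurable_compose) simp
qed (rule centre_tendsto)

text \<open>
  The density gives total mass \<open>r powr t\<close>, so that a cell of generation \<open>k\<close> has mass
  \<open>(\<kappa> ^ k * r) powr t\<close>.
\<close>

definition cantor_measure :: "'a measure" where
  "cantor_measure =
     distr (density lborel (\<lambda>u. ennreal (r powr t) * indicator {0..<1} u)) borel point"

lemma point_in_measurable:
  assumes "B \<in> sets borel"
  shows "{u \<in> {0..<1}. point u \<in> B} \<in> sets lborel"
proof -
  have [measurable]: "B \<in> sets borel" by fact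
  show ?thesis by measurable
qed

lemma emeasure_cantor_measure:
  assumes B: "B \<in> sets borel"
  shows "emeasure cantor_measure B =
    ennreal (r powr t) * emeasure lborel {u \<in> {0..<1}. point u \<in> B}"
proof -
  note m = point_in_measurable[OF B]
  have "emeasure cantor_measure B = emeasure (density lborel (\<lambda>u. ennreal (r powr t) * indicator {0..<1} u)) (point -` B)"
    unfolding cantor_measure_def using B by (subst emeasure_distr) auto
  also have "\<dots> = (\<integral>\<^sup>+u. ennreal (r powr t) * indicator {0..<1} u * indicator (point -` B) u \<partial>lborel)"
    using measurable_sets_borel[OF point_measurable B] by (subst emeasure_density) auto
  also have "\<dots> = (\<integral>\<^sup>+u. ennreal (r powr t) * indicator {u \<in> {0..<1}. point u \<in> B} u \<partial>lborel)"
    by (intro nn_integral_cong) (auto simp: indicator_def)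
  also have "\<dots> = ennreal (r powr t) * emeasure lborel {u \<in> {0..<1}. point u \<in> B}"
    using m by (rule nn_integral_cmult_indicator)
  finally show ?thesis .
qed

lemma cell_mass: "r powr t * (1 / real N ^ k) = (\<kappa> ^ k * r) powr t"
proof -
  have "(\<kappa> ^ k * r) powr t = (\<kappa> powr t) ^ k * r powr t"
    using \<kappa> r_pos by (simp add: powr_mult powr_powr powr_realpow[symmetric] mult.commute)
  also have "\<kappa> powr t = 1 / real N"
    using N_eq N_pos by (simp add: field_simps)
  finally show ?thesis by (simp add: power_divide)
qed

lemma digits_iff:
  assumes "0 \<le> u"
  shows "digits k u = d \<longleftrightarrow> u \<in> {real d / real N ^ k ..< (real d + 1) / real N ^ k}"
proof -
  have "digits k u = d \<longleftrightarrow> \<lfloor>real N ^ k * u\<rfloor> = int d"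
    using assms unfolding digits_def by (simp add: nat_eq_iff)
  also have "\<dots> \<longleftrightarrow> real d \<le> real N ^ k * u \<and> real N ^ k * u < real d + 1"
    by (simp add: floor_eq_iff)
  also have "\<dots> \<longleftrightarrow> u \<in> {real d / real N ^ k ..< (real d + 1) / real N ^ k}"
    using N_pos by (simp add: field_simps)
  finally show ?thesis .
qed

lemma emeasure_cell:
  assumes v: "v \<in> {0..<1}"
  shows "emeasure lborel {u \<in> {0..<1}. digits k u = digits k v} = ennreal (1 / real N ^ k)"
proof -
  let ?d = "digits k v"
  have d1: "real ?d + 1 \<le> real N ^ k"
  proof -
    have "real N ^ k * v < real N ^ k" using v N_pos by simp
    then have "\<lfloor>real N ^ k * v\<rfloor> < int N ^ k" by (simp add: floor_less_iff)
    then have "int ?d < int N ^ k" using N_pos unfolding digits_def by (simp)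
    then have "?d < N ^ k" by (metis of_nat_less_iff of_nat_power)
    then show ?thesis by (metis Suc_leI of_nat_Suc of_nat_le_iff of_nat_power add.commute)
  qed
  have Nk: "0 < real N ^ k" using N_pos by simp
  have "{u \<in> {0..<1}. digits k u = ?d} = {real ?d / real N ^ k ..< (real ?d + 1) / real N ^ k}"
  proof (intro set_eqI iffI)
    fix u assume "u \<in> {u \<in> {0..<1}. digits k u = ?d}"
    then have "0 \<le> u" "digits k u = ?d" by auto
    then show "u \<in> {real ?d / real N ^ k ..< (real ?d + 1) / real N ^ k}"
      using digits_iff by blast
  next
    fix u assume u: "u \<in> {real ?d / real N ^ k ..< (real ?d + 1) / real N ^ k}"
    have "0 \<le> real ?d / real N ^ k" "(real ?d + 1) / real N ^ k \<le> 1"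
      using d1 Nk by (auto simp: field_simps)
    then have "0 \<le> u" "u < 1"
      using u order_trans[of 0 "real ?d / real N ^ k" u] by auto
    with u digits_iff show "u \<in> {u \<in> {0..<1}. digits k u = ?d}" by auto
  qed
  moreover have "(real ?d + 1) / real N ^ k - real ?d / real N ^ k = 1 / real N ^ k"
    by (simp add: diff_divide_distrib[symmetric])
  ultimately show ?thesis
    using Nk by (simp add: divide_right_mono)
qed

text \<open>
  A ball whose radius is less than the scale of generation \<open>k\<close> meets at most one cell of that
  generation. The centre of the ball need not be a point of the Cantor set.
\<close>

lemma emeasure_cantor_ball_le:
  assumes \<delta>: "0 < \<delta>"
  shows "emeasure cantor_measure (ball z \<delta>) \<le> ennreal (real N * \<delta> powr t)"
proof (cases "\<delta> < r")
  case False
  have "emeasure cantor_measure (ball z \<delta>) \<le> ennreal (r powr t) * emeasure lborel {0..<1::real}"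
    by (subst emeasure_cantor_measure) (simp, intro mult_left_mono emeasure_mono, auto)
  also have "\<dots> = ennreal (r powr t)" by simp
  also have "r powr t \<le> 1 * \<delta> powr t"
    using False t_pos r_pos by (simp add: powr_mono2)
  also have "\<dots> \<le> real N * \<delta> powr t"
    using N_pos by (intro mult_right_mono) auto
  finally show ?thesis by (simp add: ennreal_leI)
next
  case True
  obtain k where k: "\<kappa> ^ Suc k * r \<le> \<delta>" "\<delta> < \<kappa> ^ k * r"
    using geometric_scale[of \<kappa> \<delta> r] \<kappa> \<delta> True by auto
  let ?P = "{u \<in> {0..<1}. point u \<in> ball z \<delta>}"
  have P: "emeasure lborel ?P \<le> ennreal (1 / real N ^ k)"
  proof (cases "?P = {}")
    case False
    then obtain v where v: "v \<in> {0..<1}" "point v \<in> ball z \<delta>" by blast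
    have "?P \<subseteq> {u \<in> {0..<1}. digits k u = digits k v}"
    proof (safe, rule ccontr)
      fix u assume u: "u \<in> {0..<1}" "point u \<in> ball z \<delta>" "digits k u \<noteq> digits k v"
      have "dist (point u) (point v) \<le> dist z (point u) + dist z (point v)"
        by (rule dist_triangle3)
      with different_cell_apart[OF u(1) v(1) u(3)] u v k show False by simp
    qed
    moreover have "{u \<in> {0..<1}. digits k u = digits k v} \<in> sets lborel"
      unfolding digits_def by measurable
    ultimately have "emeasure lborel ?P \<le> emeasure lborel {u \<in> {0..<1}. digits k u = digits k v}"
      by (rule emeasure_mono)
    with emeasure_cell[OF v(1)] show ?thesis by simp
  qed (simp only: emeasure_empty zero_le)
  have "emeasure cantor_measure (ball z \<delta>) = ennreal (r powr t) * emeasure lborel ?P"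
    by (rule emeasure_cantor_measure) simp
  also have "\<dots> \<le> ennreal (r powr t) * ennreal (1 / real N ^ k)"
    by (intro mult_left_mono P) simp
  also have "\<dots> = ennreal ((\<kappa> ^ k * r) powr t)"
    by (simp add: ennreal_mult'[symmetric] flip: cell_mass)
  also have "(\<kappa> ^ k * r) powr t = real N * (\<kappa> powr t * (\<kappa> ^ k * r) powr t)"
    using N_eq by (simp add: algebra_simps)
  also have "\<kappa> powr t * (\<kappa> ^ k * r) powr t = (\<kappa> ^ Suc k * r) powr t"
    using \<kappa> r_pos by (simp flip: powr_mult add: mult.assoc)
  also have "real N * (\<kappa> ^ Suc k * r) powr t \<le> real N * \<delta> powr t"
    using k \<kappa> r_pos t_pos by (intro mult_left_mono powr_mono2) auto
  finally show ?thesis by (simp add: ennreal_leI)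
qed

text \<open>
  The ball about a limit point contains the entire cell of that point in the first generation whose
  scale is at most \<open>\<delta> / 2\<close>.
\<close>

lemma emeasure_cantor_ball_ge:
  assumes \<delta>: "0 < \<delta>" "\<delta> < 2 * r" and v: "v \<in> {0..<1}"
  shows "ennreal ((\<kappa> / 2) powr t * \<delta> powr t) \<le> emeasure cantor_measure (ball (point v) \<delta>)"
proof -
  obtain k where k: "\<kappa> ^ Suc k * (2 * r) \<le> \<delta>" "\<delta> < \<kappa> ^ k * (2 * r)"
    using geometric_scale[of \<kappa> \<delta> "2 * r"] \<kappa> \<delta> by auto
  have pm: "{u \<in> {0..<1}. point u \<in> ball (point v) \<delta>} \<in> sets lborel"
    by (rule point_in_measurable) simp
  have "(\<kappa> / 2) powr t * \<delta> powr t = (\<kappa> * \<delta> / 2) powr t"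
    using \<kappa> \<delta> by (simp flip: powr_mult)
  also have "\<dots> \<le> (\<kappa> ^ Suc k * r) powr t"
    using k \<kappa> \<delta> t_pos by (intro powr_mono2) (auto simp: mult_left_mono field_simps)
  finally have "ennreal ((\<kappa> / 2) powr t * \<delta> powr t) \<le> ennreal ((\<kappa> ^ Suc k * r) powr t)"
    by (rule ennreal_leI)
  also have "\<dots> = ennreal (r powr t) * ennreal (1 / real N ^ Suc k)"
    by (subst cell_mass[symmetric]) (simp add: ennreal_mult'[symmetric])
  also have "\<dots> = ennreal (r powr t) * emeasure lborel {u \<in> {0..<1}. digits (Suc k) u = digits (Suc k) v}"
    by (simp only: emeasure_cell[OF v])
  also have "\<dots> \<le> ennreal (r powr t) * emeasure lborel {u \<in> {0..<1}. point u \<in> ball (point v) \<delta>}"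
  proof (intro mult_left_mono emeasure_mono pm)
    show "{u \<in> {0..<1}. digits (Suc k) u = digits (Suc k) v}
        \<subseteq> {u \<in> {0..<1}. point u \<in> ball (point v) \<delta>}"
    proof safe
      fix u assume "digits (Suc k) u = digits (Suc k) v"
      then have "dist (point v) (point u) < 2 * (\<kappa> ^ Suc k * r)"
        by (intro same_cell_close) simp
      with k show "point u \<in> ball (point v) \<delta>" by simp
    qed
  qed simp
  also have "\<dots> = emeasure cantor_measure (ball (point v) \<delta>)"
    by (rule emeasure_cantor_measure[symmetric]) simp
  finally show ?thesis .
qed

end


text \<open>
  That \<open>m\<close> lives on \<open>E\<close> is expressed by the Borel sets disjoint from \<open>E\<close>, because \<open>E\<close> is the image
  of an interval under a Borel function and need not be a Borel set. The upper bound is required at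
  all points of the space: a ball can meet several pieces while its centre lies in none.
\<close>

definition regular_piece :: "real \<Rightarrow> real \<Rightarrow> real \<Rightarrow> 'a::polish_space \<Rightarrow> real \<Rightarrow> 'a measure \<Rightarrow> 'a set \<Rightarrow> bool" where
  "regular_piece t \<alpha> \<beta> y r m E \<longleftrightarrow>
     sets m = sets borel \<and> E \<subseteq> ball y r \<and>
     (\<forall>B\<in>sets borel. B \<inter> E = {} \<longrightarrow> emeasure m B = 0) \<and>
     emeasure m UNIV = ennreal (r powr t) \<and>
     (\<forall>z \<delta>. 0 < \<delta> \<longrightarrow> emeasure m (ball z \<delta>) \<le> ennreal (\<beta> * \<delta> powr t)) \<and>
     (\<forall>z\<in>E. \<forall>\<delta>. 0 < \<delta> \<and> \<delta> < 2 * r \<longrightarrow> ennreal (\<alpha> * \<delta> powr t) \<le> emeasure m (ball z \<delta>))"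

lemma (in cantor_scheme) regular_piece_cantor:
  "regular_piece t ((\<kappa> / 2) powr t) (real N) root r cantor_measure (point ` {0..<1})"
  unfolding regular_piece_def
proof (intro conjI)
  show "sets cantor_measure = sets borel" by (simp add: cantor_measure_def)
  show "point ` {0..<1} \<subseteq> ball root r" using point_near_root by blast
  show "\<forall>B\<in>sets borel. B \<inter> point ` {0..<1} = {} \<longrightarrow> emeasure cantor_measure B = 0"
  proof (intro ballI impI)
    fix B :: "'a set" assume B: "B \<in> sets borel" "B \<inter> point ` {0..<1} = {}"
    then have "{u \<in> {0..<1}. point u \<in> B} = {}" by auto
    then show "emeasure cantor_measure B = 0"
      by (simp only: emeasure_cantor_measure[OF B(1)] emeasure_empty mult_zero_right)
  qed
  have "emeasure cantor_measure UNIV = ennreal (r powr t) * emeasure lborel {0..<1::real}"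
    by (simp only: emeasure_cantor_measure[OF borel_open[OF open_UNIV]] UNIV_I simp_thms
        Collect_mem_eq)
  then show "emeasure cantor_measure UNIV = ennreal (r powr t)" by simp
qed (use emeasure_cantor_ball_le emeasure_cantor_ball_ge in blast)+

text \<open>
  A ball has room for about \<open>(8 * \<kappa>) powr (- s)\<close> children, and \<open>N = \<kappa> powr (- t)\<close> are needed. As
  \<open>t < s\<close>, this fits if \<open>N\<close> is large enough. The choice of \<open>N\<close> depends neither on the centre nor on
  the radius of the ball, hence neither do the constants.
\<close>

lemma (in regular_space) exists_regular_piece:
  assumes t: "0 < t" "t < s"
  obtains \<alpha> \<beta> where "0 < \<alpha>" and "0 < \<beta>"
    and "\<And>y r. 0 < r \<Longrightarrow> r < R \<Longrightarrow> \<exists>m E. regular_piece t \<alpha> \<beta> (y::'a) r m E"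
proof -
  define K where "K = b * 8 powr s / a"
  have K: "0 < K" using a_pos b_pos by (simp add: K_def)
  \<comment> \<open>The first summand makes \<open>\<kappa> < 1/8\<close>, the second one makes room for \<open>N\<close> children.\<close>
  obtain N :: nat where N_large: "8 powr t + K powr (t / (s - t)) < real N"
    using reals_Archimedean2 by blast
  then have N_large1: "8 powr t < real N" "K powr (t / (s - t)) \<le> real N"
    using powr_ge_zero[of 8 t] powr_ge_zero[of K "t / (s - t)"] by linarith+
  then have N: "0 < N" using powr_ge_zero[of 8 t] by (cases N) auto
  have N8: "8 < real N powr (1 / t)"
    using powr_less_mono2[OF _ _ N_large1(1), of "1 / t"] t by (simp add: powr_powr)
  have NK: "K \<le> real N powr (s / t - 1)"
  proof -
    have "K = (K powr (t / (s - t))) powr (s / t - 1)"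
      using K t by (simp add: powr_powr field_simps)
    also have "\<dots> \<le> real N powr (s / t - 1)"
      by (rule powr_mono2) (use t N_large1 in auto)
    finally show ?thesis .
  qed
  define \<kappa> where "\<kappa> = real N powr (- (1 / t))"
  have \<kappa>: "0 < \<kappa>" "\<kappa> < 1/8"
    using N N8 by (auto simp: \<kappa>_def powr_minus field_simps)
  have N_eq: "real N * \<kappa> powr t = 1"
  proof -
    have "\<kappa> powr t = real N powr (- 1)" unfolding \<kappa>_def powr_powr using t by simp
    then show ?thesis using N by (simp add: powr_minus)
  qed
  \<comment> \<open>Children lie within \<open>\<kappa> ^ k * r / 2\<close> of their parent at mutual distance \<open>4 * (\<kappa> ^ Suc k * r)\<close>,
     which is \<open>8 * \<kappa>\<close> times that radius.\<close>
  have packing: "real N * (b * (8 * \<kappa>) powr s) \<le> a"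
  proof -
    have "\<kappa> powr s = real N powr (- (s / t))" by (simp add: \<kappa>_def powr_powr)
    then have "real N * \<kappa> powr s * real N powr (s / t - 1) = 1"
      using N by (simp add: powr_diff powr_minus)
    then have "a = a * (real N * \<kappa> powr s * real N powr (s / t - 1))" by simp
    also have "\<dots> \<ge> a * (real N * \<kappa> powr s * K)"
      using NK a_pos by (intro mult_left_mono) auto
    also have "a * (real N * \<kappa> powr s * K) = real N * (b * (8 * \<kappa>) powr s)"
      using a_pos \<kappa> by (simp add: powr_mult K_def)
    finally show ?thesis .
  qed
  have "\<exists>m E. regular_piece t ((\<kappa> / 2) powr t) (real N) y r m E" if r: "0 < r" "r < R" for y :: 'a and r
  proof -
    have "\<exists>f. (\<forall>i<N. dist c (f i) < \<kappa> ^ k * r / 2) \<and>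
        (\<forall>i<N. \<forall>j<N. i \<noteq> j \<longrightarrow> 4 * (\<kappa> ^ Suc k * r) \<le> dist (f i) (f j))" for k and c :: 'a
    proof -
      have 1: "0 < \<kappa> ^ k * r / 2" using \<kappa> r by simp
      have "\<kappa> ^ k * r \<le> 1 * r" using \<kappa> r by (intro mult_right_mono power_le_one) auto
      then have 2: "\<kappa> ^ k * r / 2 < R" using r R_pos by linarith
      have 3: "0 < 8 * \<kappa>" "8 * \<kappa> < 1" using \<kappa> by auto
      obtain f where "\<And>i. i < N \<Longrightarrow> f i \<in> ball c (\<kappa> ^ k * r / 2)"
        "\<And>i j. i < N \<Longrightarrow> j < N \<Longrightarrow> i \<noteq> j \<Longrightarrow> 8 * \<kappa> * (\<kappa> ^ k * r / 2) \<le> dist (f i) (f j)"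
        using separated_points[OF 1 2 3 packing] by metis
      then show ?thesis by (intro exI[of _ f]) (auto simp: algebra_simps)
    qed
    then have "\<exists>child. \<forall>k (c::'a). (\<forall>i<N. dist c (child k c i) < \<kappa> ^ k * r / 2) \<and>
        (\<forall>i<N. \<forall>j<N. i \<noteq> j \<longrightarrow> 4 * (\<kappa> ^ Suc k * r) \<le> dist (child k c i) (child k c j))"
      by (intro choice allI)
    then obtain child where child: "\<And>k (c::'a) i. i < N \<Longrightarrow> dist c (child k c i) < \<kappa> ^ k * r / 2"
      "\<And>k (c::'a) i j. i < N \<Longrightarrow> j < N \<Longrightarrow> i \<noteq> j \<Longrightarrow> 4 * (\<kappa> ^ Suc k * r) \<le> dist (child k c i) (child k c j)"
      by blast
    interpret cantor_scheme N \<kappa> t r y child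
      by unfold_locales (use \<kappa> t r N_eq child in auto)
    show ?thesis using regular_piece_cantor by blast
  qed
  moreover have "0 < (\<kappa> / 2) powr t" "0 < real N" using \<kappa> N by auto
  ultimately show ?thesis using that by blast
qed

section \<open>Volume decay of neighbourhoods of porous sets\<close>

lemma maximal_separated_subset:
  fixes A :: "'a::metric_space set"
  assumes "0 < \<epsilon>"
  shows "\<exists>S\<subseteq>A. (\<forall>x\<in>S. \<forall>y\<in>S. x \<noteq> y \<longrightarrow> \<epsilon> \<le> dist x y) \<and> (\<forall>x\<in>A. \<exists>y\<in>S. dist x y < \<epsilon>)"
proof -
  let ?\<C> = "{S. S \<subseteq> A \<and> (\<forall>x\<in>S. \<forall>y\<in>S. x \<noteq> y \<longrightarrow> \<epsilon> \<le> dist x y)}"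
  have "\<exists>M\<in>?\<C>. \<forall>X\<in>?\<C>. M \<subseteq> X \<longrightarrow> X = M"
  proof (rule subset_Zorn_nonempty)
    show "?\<C> \<noteq> {}" by blast
    fix \<K> assume "\<K> \<noteq> {}" "subset.chain ?\<C> \<K>"
    then have sub: "\<K> \<subseteq> ?\<C>" and chain: "\<And>S T. S \<in> \<K> \<Longrightarrow> T \<in> \<K> \<Longrightarrow> S \<subseteq> T \<or> T \<subseteq> S"
      by (auto simp only: subset_chain_def)
    have "\<epsilon> \<le> dist x y" if xy: "x \<in> \<Union>\<K>" "y \<in> \<Union>\<K>" "x \<noteq> y" for x y
    proof -
      obtain S T where ST: "S \<in> \<K>" "x \<in> S" "T \<in> \<K>" "y \<in> T" using xy by blast
      then obtain U where "U \<in> \<K>" "x \<in> U" "y \<in> U" using chain[of S T] by blast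
      with sub xy(3) show ?thesis by blast
    qed
    then show "\<Union>\<K> \<in> ?\<C>" using sub by auto
  qed
  then obtain S where S: "S \<in> ?\<C>" and max: "\<forall>X\<in>?\<C>. S \<subseteq> X \<longrightarrow> X = S"
    by (rule bexE)
  then have S: "S \<subseteq> A" "\<And>x y. x \<in> S \<Longrightarrow> y \<in> S \<Longrightarrow> x \<noteq> y \<Longrightarrow> \<epsilon> \<le> dist x y" by auto
  have net: "\<exists>y\<in>S. dist x y < \<epsilon>" if "x \<in> A" for x
  proof (rule ccontr)
    assume no: "\<not> (\<exists>y\<in>S. dist x y < \<epsilon>)"
    then have "\<forall>y\<in>S. \<epsilon> \<le> dist x y \<and> \<epsilon> \<le> dist y x" by (auto simp: not_less dist_commute)
    then have "insert x S \<in> ?\<C>" using S that by auto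
    from bspec[OF max this] have "x \<in> S"
      using subset_insertI[of S x] by auto
    with no have "\<not> dist x x < \<epsilon>" by blast
    with assms show False by simp
  qed
  with S show ?thesis by (intro exI[of _ S]) simp
qed

definition neighbourhood :: "'a::metric_space set \<Rightarrow> real \<Rightarrow> 'a set" where
  "neighbourhood A \<delta> = (\<Union>x\<in>A. ball x \<delta>)"

lemma open_neighbourhood: "open (neighbourhood A \<delta>)"
  unfolding neighbourhood_def by blast

lemma neighbourhood_mono: "A \<subseteq> B \<Longrightarrow> \<delta> \<le> \<delta>' \<Longrightarrow> neighbourhood A \<delta> \<subseteq> neighbourhood B \<delta>'"
  unfolding neighbourhood_def by force

lemma disjoint_family_balls:
  fixes T :: "'a::metric_space set"
  assumes "\<And>x y. x \<in> T \<Longrightarrow> y \<in> T \<Longrightarrow> x \<noteq> y \<Longrightarrow> 2 * \<delta> \<le> dist x y"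
  shows "disjoint_family_on (\<lambda>x. ball x \<delta>) T"
proof -
  have "ball x \<delta> \<inter> ball y \<delta> = {}" if "2 * \<delta> \<le> dist x y" for x y :: 'a
    using that by (intro disjoint_ballI) simp
  with assms show ?thesis unfolding disjoint_family_on_def by blast
qed

text \<open>
  The factor 2 leaves a margin: the points of the concentric ball of radius \<open>\<eta> * \<delta>\<close> have distance
  at least \<open>\<eta> * \<delta>\<close> from \<open>A\<close>.
\<close>

definition porous_at_scale :: "real \<Rightarrow> 'a::metric_space set \<Rightarrow> real \<Rightarrow> bool" where
  "porous_at_scale \<eta> A \<delta> \<longleftrightarrow> (\<forall>x\<in>A. \<exists>y. ball y (2 * (\<eta> * \<delta>)) \<subseteq> ball x \<delta> - A)"

lemma porous_at_scale_subset:
  "porous_at_scale \<eta> A \<delta> \<Longrightarrow> A' \<subseteq> A \<Longrightarrow> porous_at_scale \<eta> A' \<delta>"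
  unfolding porous_at_scale_def by blast

context regular_space
begin

lemma card_separated_le:
  assumes "finite T" "T \<subseteq> A" and \<delta>: "0 < \<delta>" "\<delta> < R"
    and sep: "\<And>x y. x \<in> T \<Longrightarrow> y \<in> T \<Longrightarrow> x \<noteq> y \<Longrightarrow> 2 * \<delta> \<le> dist x y"
  shows "ennreal (real (card T) * (a * \<delta> powr s)) \<le> emeasure \<mu> (neighbourhood A \<delta>)"
proof -
  have "ennreal (real (card T) * (a * \<delta> powr s)) = (\<Sum>x\<in>T. ennreal (a * \<delta> powr s))"
    using a_pos by (simp add: ennreal_mult ennreal_of_nat_eq_real_of_nat)
  also have "\<dots> \<le> (\<Sum>x\<in>T. emeasure \<mu> (ball x \<delta>))"
    by (intro sum_mono lower \<delta>)
  also have "\<dots> = emeasure \<mu> (\<Union>x\<in>T. ball x \<delta>)"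
    by (rule sum_emeasure) (use assms disjoint_family_balls[OF sep] in \<open>auto simp: sets_\<mu>\<close>)
  also have "\<dots> \<le> emeasure \<mu> (neighbourhood A \<delta>)"
    using assms(2) open_neighbourhood[of A \<delta>]
    by (intro emeasure_mono) (auto simp: neighbourhood_def sets_\<mu> borel_open)
  finally show ?thesis .
qed

lemma finite_separated:
  assumes fin: "emeasure \<mu> (neighbourhood A \<delta>) < \<infinity>" and "T \<subseteq> A" and \<delta>: "0 < \<delta>" "\<delta> < R"
    and sep: "\<And>x y. x \<in> T \<Longrightarrow> y \<in> T \<Longrightarrow> x \<noteq> y \<Longrightarrow> 2 * \<delta> \<le> dist x y"
  shows "finite T"
proof (rule ccontr)
  assume inf: "infinite T"
  let ?w = "measure \<mu> (neighbourhood A \<delta>)"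
  have pos: "0 < a * \<delta> powr s" using a_pos \<delta> by simp
  obtain n :: nat where n: "?w / (a * \<delta> powr s) < real n" using reals_Archimedean2 by blast
  obtain T' where T': "finite T'" "card T' = n" "T' \<subseteq> T"
    using infinite_arbitrarily_large[OF inf] by blast
  have "ennreal (real n * (a * \<delta> powr s)) \<le> emeasure \<mu> (neighbourhood A \<delta>)"
    using card_separated_le[OF T'(1) _ \<delta>, of A] T' sep assms(2) by blast
  also have "\<dots> = ennreal ?w"
    using fin by (intro emeasure_eq_ennreal_measure) auto
  finally have "real n * (a * \<delta> powr s) \<le> ?w"
    by (simp add: ennreal_le_iff)
  with n pos show False by (simp add: field_simps)
qed

text \<open>
  The fraction is the proportion of the \<open>\<delta>\<close>-neighbourhood that halved pores are sure to fill: each of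
  them has measure at least \<open>a * (\<eta> * \<delta>) powr s\<close>, and balls of radius \<open>3 * \<delta>\<close>, one for each of these
  pores, cover the neighbourhood.
\<close>

definition decay :: "real \<Rightarrow> real" where
  "decay \<eta> = 1 - a * \<eta> powr s / (b * 3 powr s)"

lemma decay_bounds:
  assumes "0 < \<eta>" "\<eta> \<le> 1"
  shows "0 < decay \<eta>" "decay \<eta> < 1"
proof -
  have "\<eta> powr s < 3 powr s" using assms s_pos by (intro powr_less_mono2) auto
  then have "a * \<eta> powr s < b * 3 powr s"
    using a_le_b a_pos b_pos by (intro mult_le_less_imp_less) auto
  then show "0 < decay \<eta>" "decay \<eta> < 1"
    using a_pos b_pos assms by (auto simp: decay_def)
qed

text \<open>
  For a maximal \<open>2 * \<delta>\<close>-separated set of points of \<open>A\<close> the balls of radius \<open>\<delta>\<close> are disjoint and the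
  balls of radius \<open>3 * \<delta>\<close> cover the \<open>\<delta>\<close>-neighbourhood. The halved pores in the former are lost on
  passing to the \<open>\<eta> * \<delta>\<close>-neighbourhood.
\<close>

lemma neighbourhood_decay:
  assumes \<eta>: "0 < \<eta>" "\<eta> \<le> 1" and \<delta>: "0 < \<delta>" "3 * \<delta> < R"
    and porous: "porous_at_scale \<eta> A \<delta>"
    and fin: "emeasure \<mu> (neighbourhood A \<delta>) < \<infinity>"
  shows "measure \<mu> (neighbourhood A (\<eta> * \<delta>)) \<le> decay \<eta> * measure \<mu> (neighbourhood A \<delta>)"
proof -
  let ?W = "neighbourhood A \<delta>" and ?W' = "neighbourhood A (\<eta> * \<delta>)"
  obtain S where S: "S \<subseteq> A" and sep: "\<And>x y. x \<in> S \<Longrightarrow> y \<in> S \<Longrightarrow> x \<noteq> y \<Longrightarrow> 2 * \<delta> \<le> dist x y"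
    and net: "\<And>x. x \<in> A \<Longrightarrow> \<exists>y\<in>S. dist x y < 2 * \<delta>"
    using maximal_separated_subset[of "2 * \<delta>" A] \<delta> by auto
  have "finite S" using finite_separated[OF fin S _ _ sep] \<delta> by auto
  obtain y where y: "\<And>x. x \<in> S \<Longrightarrow> ball (y x) (2 * (\<eta> * \<delta>)) \<subseteq> ball x \<delta> - A"
    using porous S unfolding porous_at_scale_def by (metis subsetD)
  have \<eta>\<delta>: "0 < \<eta> * \<delta>" "\<eta> * \<delta> \<le> \<delta>" "\<eta> * \<delta> < R"
    using \<eta> \<delta> mult_right_mono[of \<eta> 1 \<delta>] by (simp, simp, linarith)
  let ?D = "\<Union>x\<in>S. ball (y x) (\<eta> * \<delta>)"
  have y': "ball (y x) (\<eta> * \<delta>) \<subseteq> ball x \<delta>" if "x \<in> S" for x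
  proof -
    have "ball (y x) (\<eta> * \<delta>) \<subseteq> ball (y x) (2 * (\<eta> * \<delta>))"
      using \<eta>\<delta> by (intro subset_ball) linarith
    with y[OF that] show ?thesis by blast
  qed
  have disj: "?W' \<inter> ?D = {}"
  proof -
    have False if "x \<in> S" "z \<in> A" "p \<in> ball (y x) (\<eta> * \<delta>)" "p \<in> ball z (\<eta> * \<delta>)" for x z p
    proof -
      have "dist (y x) z \<le> dist (y x) p + dist z p" by (rule dist_triangle2)
      with that have "z \<in> ball (y x) (2 * (\<eta> * \<delta>))" by auto
      with y[OF that(1)] that show False by blast
    qed
    then show ?thesis unfolding neighbourhood_def by blast
  qed
  have openW: "?W \<in> sets \<mu>" "?W' \<in> sets \<mu>" "?D \<in> sets \<mu>"
    by (auto simp: sets_\<mu> open_neighbourhood intro!: borel_open open_UN)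
  have "?W' \<subseteq> ?W" by (rule neighbourhood_mono) (use \<eta>\<delta> in auto)
  moreover have "?D \<subseteq> ?W" using y' S unfolding neighbourhood_def by blast
  ultimately have sub: "?W' \<union> ?D \<subseteq> ?W" by blast
  have fm: "?W \<in> fmeasurable \<mu>" using fin openW by (simp add: fmeasurable_def)
  have fm': "?W' \<in> fmeasurable \<mu>" "?D \<in> fmeasurable \<mu>"
    by (rule fmeasurableI2[OF fm _ openW(2)], use sub in blast,
        rule fmeasurableI2[OF fm _ openW(3)], use sub in blast)
  have "measure \<mu> ?W' + measure \<mu> ?D = measure \<mu> (?W' \<union> ?D)"
    using disj fm' openW by (intro measure_Union[symmetric]) (auto simp: fmeasurable_def)
  also have "\<dots> \<le> measure \<mu> ?W"
    using sub fm fm' by (intro measure_mono_fmeasurable) auto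
  finally have 1: "measure \<mu> ?W' + measure \<mu> ?D \<le> measure \<mu> ?W" .
  have "ennreal (real (card S) * (a * (\<eta> * \<delta>) powr s)) = (\<Sum>x\<in>S. ennreal (a * (\<eta> * \<delta>) powr s))"
    using a_pos by (simp add: ennreal_mult ennreal_of_nat_eq_real_of_nat)
  also have "\<dots> \<le> (\<Sum>x\<in>S. emeasure \<mu> (ball (y x) (\<eta> * \<delta>)))"
    by (intro sum_mono lower \<eta>\<delta>)
  also have "\<dots> = emeasure \<mu> ?D"
  proof (rule sum_emeasure)
    show "disjoint_family_on (\<lambda>x. ball (y x) (\<eta> * \<delta>)) S"
      using disjoint_family_balls[OF sep] y' unfolding disjoint_family_on_def by blast
  qed (use \<open>finite S\<close> in \<open>auto simp: sets_\<mu>\<close>)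
  also have "\<dots> = ennreal (measure \<mu> ?D)"
    using fm' by (intro emeasure_eq_measure2) auto
  finally have 2: "real (card S) * (a * (\<eta> * \<delta>) powr s) \<le> measure \<mu> ?D"
    by (simp add: ennreal_le_iff)
  have "ennreal (measure \<mu> ?W) = emeasure \<mu> ?W"
    using fm by (intro emeasure_eq_measure2[symmetric]) auto
  also have "\<dots> \<le> emeasure \<mu> (\<Union>x\<in>S. ball x (3 * \<delta>))"
  proof (rule emeasure_mono)
    show "?W \<subseteq> (\<Union>x\<in>S. ball x (3 * \<delta>))"
    proof
      fix p assume "p \<in> ?W"
      then obtain z where z: "z \<in> A" "dist z p < \<delta>" unfolding neighbourhood_def by auto
      obtain x where x: "x \<in> S" "dist z x < 2 * \<delta>" using net z by blast
      have "dist x p \<le> dist z x + dist z p" by (rule dist_triangle3)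
      with x z have "p \<in> ball x (3 * \<delta>)" by simp
      with x show "p \<in> (\<Union>x\<in>S. ball x (3 * \<delta>))" by blast
    qed
    show "(\<Union>x\<in>S. ball x (3 * \<delta>)) \<in> sets \<mu>"
      unfolding sets_\<mu> by (intro borel_open open_UN ballI open_ball)
  qed
  also have "\<dots> \<le> (\<Sum>x\<in>S. emeasure \<mu> (ball x (3 * \<delta>)))"
    using \<open>finite S\<close> by (intro emeasure_subadditive_finite) (auto simp: sets_\<mu>)
  also have "\<dots> \<le> (\<Sum>x\<in>S. ennreal (b * (3 * \<delta>) powr s))"
    using \<delta> by (intro sum_mono upper) auto
  also have "\<dots> = ennreal (real (card S) * (b * (3 * \<delta>) powr s))"
    using b_pos by (simp add: ennreal_mult ennreal_of_nat_eq_real_of_nat)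
  finally have 3: "measure \<mu> ?W \<le> real (card S) * (b * (3 * \<delta>) powr s)"
    using b_pos by (simp add: ennreal_le_iff)
  have "(1 - decay \<eta>) * measure \<mu> ?W \<le> (1 - decay \<eta>) * (real (card S) * (b * (3 * \<delta>) powr s))"
    by (rule mult_left_mono[OF 3]) (use decay_bounds[OF \<eta>] in simp)
  also have "\<dots> = real (card S) * (a * (\<eta> * \<delta>) powr s)"
    using b_pos \<eta> \<delta> by (simp add: decay_def powr_mult)
  finally show ?thesis using 1 2 by (simp add: algebra_simps)
qed

lemma neighbourhood_decay_iterated:
  fixes A :: "'a set"
  assumes \<eta>: "0 < \<eta>" "\<eta> \<le> 1" and r: "0 < r" "3 * r < R"
    and porous: "\<And>\<delta>. 0 < \<delta> \<Longrightarrow> \<delta> \<le> r \<Longrightarrow> porous_at_scale \<eta> A \<delta>"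
    and fin: "emeasure \<mu> (neighbourhood A r) < \<infinity>"
  shows "measure \<mu> (neighbourhood A (\<eta> ^ m * r)) \<le> decay \<eta> ^ m * measure \<mu> (neighbourhood A r)"
proof (induction m)
  case (Suc m)
  have le: "\<eta> ^ m * r \<le> r" and pos: "0 < \<eta> ^ m * r"
    using \<eta> r mult_right_mono[OF power_le_one[of \<eta> m], of r] by auto
  have small: "3 * (\<eta> ^ m * r) < R" using le r by linarith
  have "emeasure \<mu> (neighbourhood A (\<eta> ^ m * r)) \<le> emeasure \<mu> (neighbourhood A r)"
    by (intro emeasure_mono neighbourhood_mono le) (auto simp: sets_\<mu> open_neighbourhood)
  then have "measure \<mu> (neighbourhood A (\<eta> * (\<eta> ^ m * r))) \<le>
      decay \<eta> * measure \<mu> (neighbourhood A (\<eta> ^ m * r))"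
    using fin by (intro neighbourhood_decay \<eta> porous le pos small) (rule le_less_trans)
  also have "\<dots> \<le> decay \<eta> * (decay \<eta> ^ m * measure \<mu> (neighbourhood A r))"
    using decay_bounds[OF \<eta>] by (intro mult_left_mono Suc.IH) auto
  finally show ?case by (simp add: mult.assoc)
qed simp

text \<open>
  The balls about separated points fill part of a small neighbourhood of the set, whose measure
  is controlled by the iterated decay. This bound says that the Assouad dimension of a porous
  set is less than \<open>s\<close>.
\<close>

lemma card_separated_porous_le:
  fixes A :: "'a set"
  assumes \<eta>: "0 < \<eta>" "\<eta> \<le> 1" and r: "0 < r" "3 * r < R"
    and porous: "\<And>\<delta>. 0 < \<delta> \<Longrightarrow> \<delta> \<le> r \<Longrightarrow> porous_at_scale \<eta> A \<delta>"
    and T: "T \<subseteq> A \<inter> ball z (2 * r)"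
    and sep: "\<And>x y. x \<in> T \<Longrightarrow> y \<in> T \<Longrightarrow> x \<noteq> y \<Longrightarrow> \<eta> ^ m * r \<le> dist x y"
  shows "finite T" and "real (card T) \<le> b / a * 6 powr s * (decay \<eta> * \<eta> powr (- s)) ^ m"
proof -
  let ?A = "A \<inter> ball z (2 * r)"
  have sub: "neighbourhood ?A r \<subseteq> ball z (3 * r)"
  proof
    fix p assume "p \<in> neighbourhood ?A r"
    then obtain x where "dist z x < 2 * r" "dist x p < r" unfolding neighbourhood_def by auto
    then show "p \<in> ball z (3 * r)" using dist_triangle[of z p x] by simp
  qed
  have up: "emeasure \<mu> (neighbourhood ?A r) \<le> ennreal (b * (3 * r) powr s)"
    using emeasure_mono[OF sub, of \<mu>] upper[of "3 * r" z] r by (auto simp: sets_\<mu>)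
  then have fin: "emeasure \<mu> (neighbourhood ?A r) < \<infinity>"
    using le_less_trans ennreal_less_top by fastforce
  define \<delta> where "\<delta> = \<eta> ^ m * r / 2"
  have le: "\<eta> ^ m * r \<le> r" and pos: "0 < \<eta> ^ m * r"
    using \<eta> r mult_right_mono[OF power_le_one[of \<eta> m], of r] by auto
  have \<delta>: "0 < \<delta>" "\<delta> < R" "\<delta> \<le> \<eta> ^ m * r"
    using le pos r unfolding \<delta>_def by linarith+
  have sep': "2 * \<delta> \<le> dist x y" if "x \<in> T" "y \<in> T" "x \<noteq> y" for x y
    using sep[OF that] by (simp add: \<delta>_def)
  have mono: "emeasure \<mu> (neighbourhood ?A \<delta>) \<le> emeasure \<mu> (neighbourhood ?A (\<eta> ^ m * r))"
    "emeasure \<mu> (neighbourhood ?A (\<eta> ^ m * r)) \<le> emeasure \<mu> (neighbourhood ?A r)"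
    using \<delta>(3) le
    by (intro emeasure_mono neighbourhood_mono order_refl; simp add: sets_\<mu> open_neighbourhood)+
  show "finite T"
    by (rule finite_separated[OF _ T \<delta>(1,2) sep']) (use mono fin in auto)
  have "ennreal (real (card T) * (a * \<delta> powr s)) \<le> emeasure \<mu> (neighbourhood ?A \<delta>)"
    using card_separated_le[OF \<open>finite T\<close> T \<delta>(1,2) sep'] .
  also have "\<dots> \<le> emeasure \<mu> (neighbourhood ?A (\<eta> ^ m * r))" by (rule mono)
  also have "\<dots> = ennreal (measure \<mu> (neighbourhood ?A (\<eta> ^ m * r)))"
    using mono(2) fin by (intro emeasure_eq_ennreal_measure) (auto simp: top_unique)
  finally have "real (card T) * (a * \<delta> powr s) \<le> measure \<mu> (neighbourhood ?A (\<eta> ^ m * r))"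
    by (simp add: ennreal_le_iff)
  also have "\<dots> \<le> decay \<eta> ^ m * measure \<mu> (neighbourhood ?A r)"
    by (rule neighbourhood_decay_iterated[OF \<eta> r _ fin])
      (rule porous_at_scale_subset[OF porous], auto)
  also have "\<dots> \<le> decay \<eta> ^ m * (b * (3 * r) powr s)"
    using up b_pos decay_bounds[OF \<eta>]
    by (intro mult_left_mono) (auto simp: measure_def enn2real_leI)
  finally have *: "real (card T) * (a * \<delta> powr s) \<le> decay \<eta> ^ m * (b * (3 * r) powr s)" .
  have "(\<eta> ^ m) powr s = (\<eta> powr s) ^ m"
    using \<eta> by (simp add: powr_powr mult.commute flip: powr_realpow)
  then have "(\<eta> ^ m) powr s * (\<eta> powr - s) ^ m = 1"
    using \<eta> by (simp add: powr_minus flip: power_mult_distrib)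
  moreover have "(3 * r) powr s = 6 powr s * (r / 2) powr s"
    using r by (simp flip: powr_mult)
  moreover have "\<delta> powr s = (\<eta> ^ m) powr s * (r / 2) powr s"
    using r \<eta> by (simp add: \<delta>_def flip: powr_mult)
  ultimately have "real (card T) * a * (r / 2) powr s * ((\<eta> ^ m) powr s)
     \<le> (decay \<eta> ^ m * b * 6 powr s) * (r / 2) powr s * ((\<eta> powr - s) ^ m * (\<eta> ^ m) powr s)"
    using * by (simp add: mult_ac)
  then have "real (card T) * a \<le> decay \<eta> ^ m * b * 6 powr s * (\<eta> powr - s) ^ m"
    using r \<eta> by (simp add: mult_ac)
  then show "real (card T) \<le> b / a * 6 powr s * (decay \<eta> * \<eta> powr (- s)) ^ m"
    using a_pos by (simp add: field_simps power_mult_distrib)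
qed

end

section \<open>Sums of families of Borel measures\<close>

definition sum_measure :: "'i set \<Rightarrow> ('i \<Rightarrow> 'a::topological_space measure) \<Rightarrow> 'a measure" where
  "sum_measure I m = measure_of UNIV (sets borel) (\<lambda>B. \<integral>\<^sup>+i. emeasure (m i) B \<partial>count_space I)"

lemma sets_sum_measure [simp]: "sets (sum_measure I m) = sets borel"
  unfolding sum_measure_def using sets.sigma_sets_eq[of borel] by (simp add: sets_measure_of_conv)

lemma emeasure_sum_measure:
  fixes m :: "'i \<Rightarrow> 'a::topological_space measure"
  assumes sets: "\<And>i. i \<in> I \<Longrightarrow> sets (m i) = sets borel" and B: "B \<in> sets borel"
  shows "emeasure (sum_measure I m) B = (\<integral>\<^sup>+i. emeasure (m i) B \<partial>count_space I)"
proof (rule emeasure_measure_of[OF sum_measure_def])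
  show "positive (sets (sum_measure I m)) (\<lambda>B. \<integral>\<^sup>+i. emeasure (m i) B \<partial>count_space I)"
    by (simp add: positive_def)
  show "countably_additive (sets (sum_measure I m)) (\<lambda>B. \<integral>\<^sup>+i. emeasure (m i) B \<partial>count_space I)"
  proof (rule countably_additiveI)
    fix D :: "nat \<Rightarrow> 'a set"
    assume D: "range D \<subseteq> sets (sum_measure I m)" "disjoint_family D"
    have "(\<Sum>n. \<integral>\<^sup>+i. emeasure (m i) (D n) \<partial>count_space I) =
        (\<integral>\<^sup>+i. (\<Sum>n. emeasure (m i) (D n)) \<partial>count_space I)"
      by (rule nn_integral_suminf[symmetric]) simp
    also have "\<dots> = (\<integral>\<^sup>+i. emeasure (m i) (\<Union>n. D n) \<partial>count_space I)"
      using D sets by (intro nn_integral_cong suminf_emeasure) auto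
    finally show "(\<Sum>n. \<integral>\<^sup>+i. emeasure (m i) (D n) \<partial>count_space I) =
        (\<integral>\<^sup>+i. emeasure (m i) (\<Union>n. D n) \<partial>count_space I)" .
  qed
qed (use B in auto)

lemma sum_measure_component_le:
  assumes "\<And>i. i \<in> I \<Longrightarrow> sets (m i) = sets borel" and "B \<in> sets borel" and "i \<in> I"
  shows "emeasure (m i) B \<le> emeasure (sum_measure I m) B"
proof -
  have "emeasure (m i) B \<le> (\<integral>\<^sup>+i. emeasure (m i) B \<partial>count_space I)"
    using assms(3) by (rule nn_integral_ge_point)
  also have "\<dots> = emeasure (sum_measure I m) B"
    using assms(1,2) by (rule emeasure_sum_measure[symmetric])
  finally show ?thesis .
qed

lemma emeasure_sum_measure_le:
  assumes "\<And>i. i \<in> I \<Longrightarrow> sets (m i) = sets borel" and "B \<in> sets borel"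
    and T: "finite T" "T \<subseteq> I" and zero: "\<And>i. i \<in> I - T \<Longrightarrow> emeasure (m i) B = 0"
    and le: "\<And>i. i \<in> T \<Longrightarrow> emeasure (m i) B \<le> ennreal c"
    and card: "real (card T) \<le> n" and c: "0 \<le> c"
  shows "emeasure (sum_measure I m) B \<le> ennreal (n * c)"
proof -
  have "emeasure (sum_measure I m) B = (\<integral>\<^sup>+i. emeasure (m i) B \<partial>count_space I)"
    using assms(1,2) by (rule emeasure_sum_measure)
  also have "\<dots> = (\<Sum>i\<in>T. emeasure (m i) B)"
    using T zero by (intro nn_integral_count_space') auto
  also have "\<dots> \<le> (\<Sum>i\<in>T. ennreal c)" by (intro sum_mono le)
  also have "\<dots> = ennreal (real (card T) * c)"
    using c by (simp add: ennreal_mult ennreal_of_nat_eq_real_of_nat)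
  also have "\<dots> \<le> ennreal (n * c)"
    using card c by (intro ennreal_leI mult_right_mono)
  finally show ?thesis .
qed

section \<open>Filling the pores\<close>

lemma card_le_2_if_neighbours:
  fixes K :: "nat set"
  assumes "finite K" and "\<And>k l. k \<in> K \<Longrightarrow> l \<in> K \<Longrightarrow> k < l \<Longrightarrow> l \<le> Suc k"
  shows "card K \<le> 2"
proof (cases "K = {}")
  case False
  have "K \<subseteq> {Min K, Suc (Min K)}"
  proof
    fix k assume "k \<in> K"
    then show "k \<in> {Min K, Suc (Min K)}"
      using assms(2)[of "Min K" k] Min_in[OF assms(1) False] Min_le[OF assms(1), of k]
      by (cases "k = Min K") auto
  qed
  then show ?thesis using card_mono[of "{Min K, Suc (Min K)}" K] by simp
qed simp

lemma sum_shifted_powers_le: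
  fixes q :: real
  assumes "0 \<le> q" "q < 1"
  shows "(\<Sum>k\<in>{j..<n}. q ^ (k - j)) \<le> 1 / (1 - q)"
proof -
  have "(\<Sum>k\<in>{j..<n}. q ^ (k - j)) = (\<Sum>i<n - j. q ^ i)"
    by (rule sum.reindex_bij_witness[of _ "\<lambda>i. i + j" "\<lambda>k. k - j"]) auto
  also have "\<dots> = (1 - q ^ (n - j)) / (1 - q)"
    using assms sum_gp_strict[of q "n - j"] by simp
  also have "\<dots> \<le> 1 / (1 - q)"
    using assms by (intro divide_right_mono) auto
  finally show ?thesis .
qed

lemma regular_pieceD:
  assumes "regular_piece t \<alpha> \<beta> y r m E"
  shows "sets m = sets borel" "E \<subseteq> ball y r"
    "B \<in> sets borel \<Longrightarrow> B \<inter> E = {} \<Longrightarrow> emeasure m B = 0"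
    "emeasure m UNIV = ennreal (r powr t)"
    "0 < \<delta> \<Longrightarrow> emeasure m (ball z \<delta>) \<le> ennreal (\<beta> * \<delta> powr t)"
    "z \<in> E \<Longrightarrow> 0 < \<delta> \<Longrightarrow> \<delta> < 2 * r \<Longrightarrow> ennreal (\<alpha> * \<delta> powr t) \<le> emeasure m (ball z \<delta>)"
  using assms unfolding regular_piece_def by simp_all

lemma regular_piece_total_le:
  assumes piece: "regular_piece t \<alpha> \<beta> y r m E" and B: "B \<in> sets borel"
  shows "emeasure m B \<le> ennreal (r powr t)"
    and "E \<subseteq> B \<Longrightarrow> ennreal (r powr t) \<le> emeasure m B"
proof -
  note p = regular_pieceD[OF piece]
  show "emeasure m B \<le> ennreal (r powr t)"
    unfolding p(4)[symmetric] by (rule emeasure_mono) (auto simp: p(1))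
  assume "E \<subseteq> B"
  then have "emeasure m (- B) = 0" using B by (intro p(3)) auto
  moreover have "emeasure m (B \<union> - B) \<le> emeasure m B + emeasure m (- B)"
    using B by (intro emeasure_subadditive) (auto simp: p(1))
  ultimately show "ennreal (r powr t) \<le> emeasure m B"
    by (simp add: p(4))
qed

text \<open>
  The pieces \<open>E k x\<close> of level \<open>k\<close> are indexed by the points \<open>x\<close> of a maximal separated subset \<open>S k\<close>
  of \<open>A\<close>. A piece occupies only the halved pore at \<open>x\<close>, which keeps it away from \<open>A\<close>. The
  assumption \<open>ratio\<close> is where \<open>t\<close> has to be close to \<open>s\<close>.
\<close>

locale pore_filling = regular_space \<mu> s a b R
  for \<mu> :: "'a::polish_space measure" and s a b R :: real +
  fixes A :: "'a set" and \<eta> r0 t \<alpha> \<beta> :: real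
    and S :: "nat \<Rightarrow> 'a set" and pore :: "nat \<Rightarrow> 'a \<Rightarrow> 'a"
    and m :: "nat \<Rightarrow> 'a \<Rightarrow> 'a measure" and E :: "nat \<Rightarrow> 'a \<Rightarrow> 'a set"
  assumes \<eta>: "0 < \<eta>" "\<eta> \<le> 1/4" and r0: "0 < r0" "3 * r0 < R"
    and t_pos: "0 < t" and \<alpha>: "0 < \<alpha>" and \<beta>: "0 < \<beta>"
    and porous: "\<And>\<delta>. 0 < \<delta> \<Longrightarrow> \<delta> \<le> r0 \<Longrightarrow> porous_at_scale \<eta> A \<delta>"
    and ratio: "decay \<eta> * \<eta> powr (- s) * \<eta> powr t < 1"
    and S_subset: "S k \<subseteq> A"
    and S_sep: "x \<in> S k \<Longrightarrow> x' \<in> S k \<Longrightarrow> x \<noteq> x' \<Longrightarrow> \<eta> ^ k * r0 \<le> dist x x'"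
    and S_net: "x \<in> A \<Longrightarrow> \<exists>x'\<in>S k. dist x x' < \<eta> ^ k * r0"
    and pore: "x \<in> S k \<Longrightarrow> ball (pore k x) (2 * (\<eta> ^ Suc k * r0)) \<subseteq> ball x (\<eta> ^ k * r0) - A"
    and piece: "x \<in> S k \<Longrightarrow> regular_piece t \<alpha> \<beta> (pore k x) (\<eta> ^ Suc k * r0) (m k x) (E k x)"
begin

lemma radius_pos: "0 < \<eta> ^ k * r0"
  using \<eta> r0 by simp

lemma radius_mono: "j \<le> k \<Longrightarrow> \<eta> ^ k * r0 \<le> \<eta> ^ j * r0"
  using \<eta> r0 by (intro mult_right_mono power_decreasing) auto

lemma E_near:
  assumes x: "x \<in> S k"
  shows "E k x \<subseteq> ball x (\<eta> ^ k * r0)"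
proof -
  have "E k x \<subseteq> ball (pore k x) (\<eta> ^ Suc k * r0)"
    by (rule regular_pieceD(2)[OF piece[OF x]])
  also have "\<dots> \<subseteq> ball (pore k x) (2 * (\<eta> ^ Suc k * r0))"
    using radius_pos[of "Suc k"] by (intro subset_ball) linarith
  also have "\<dots> \<subseteq> ball x (\<eta> ^ k * r0)" using pore[OF x] by blast
  finally show ?thesis .
qed

lemma E_far: "x \<in> S k \<Longrightarrow> e \<in> E k x \<Longrightarrow> z \<in> A \<Longrightarrow> \<eta> ^ Suc k * r0 \<le> dist e z"
proof (rule ccontr)
  assume x: "x \<in> S k" and e: "e \<in> E k x" and z: "z \<in> A" and "\<not> \<eta> ^ Suc k * r0 \<le> dist e z"
  moreover have "dist (pore k x) e < \<eta> ^ Suc k * r0"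
    using regular_pieceD(2)[OF piece[OF x]] e by auto
  moreover have "dist (pore k x) z \<le> dist (pore k x) e + dist e z" by (rule dist_triangle)
  ultimately have "z \<in> ball (pore k x) (2 * (\<eta> ^ Suc k * r0))" by auto
  with pore[OF x] z show False by blast
qed

definition level :: "nat \<Rightarrow> 'a measure" where
  "level k = sum_measure (S k) (m k)"

definition \<nu> :: "'a measure" where
  "\<nu> = sum_measure UNIV level"

lemma sets_m: "x \<in> S k \<Longrightarrow> sets (m k x) = sets borel"
  using regular_pieceD(1)[OF piece] .

lemma sets_level: "sets (level k) = sets borel"
  by (simp add: level_def)

lemma emeasure_\<nu>: "B \<in> sets borel \<Longrightarrow> emeasure \<nu> B = (\<Sum>k. emeasure (level k) B)"
  unfolding \<nu>_def by (simp add: emeasure_sum_measure sets_level nn_integral_count_space_nat)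

lemma piece_le_\<nu>:
  assumes "x \<in> S k" "B \<in> sets borel"
  shows "emeasure (m k x) B \<le> emeasure \<nu> B"
proof -
  have "emeasure (m k x) B \<le> emeasure (level k) B"
    unfolding level_def using assms sets_m by (intro sum_measure_component_le)
  also have "\<dots> \<le> emeasure \<nu> B"
    unfolding \<nu>_def using assms sets_level by (intro sum_measure_component_le) auto
  finally show ?thesis .
qed

definition touching :: "'a \<Rightarrow> real \<Rightarrow> nat \<Rightarrow> 'a set" where
  "touching z \<delta> k = {x \<in> S k. E k x \<inter> ball z \<delta> \<noteq> {}}"

definition packing_const :: real where
  "packing_const = b / a * 6 powr s"

lemma packing_const_pos: "0 < packing_const"
  using a_pos b_pos by (simp add: packing_const_def)

text \<open>
  Pieces of level \<open>k\<close> lie near their base points, so that the base points of those meeting the ball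
  form a separated subset of \<open>A\<close> in a ball of twice the larger scale.
\<close>

lemma card_touching:
  assumes "j \<le> k" and \<delta>: "\<delta> \<le> \<eta> ^ j * r0"
  shows "finite (touching z \<delta> k)"
    and "real (card (touching z \<delta> k)) \<le> packing_const * (decay \<eta> * \<eta> powr (- s)) ^ (k - j)"
proof -
  let ?r = "\<eta> ^ j * r0"
  have r_le: "?r \<le> r0" using radius_mono[of 0 j] by simp
  then have r: "0 < ?r" "3 * ?r < R" "?r \<le> r0" using radius_pos[of j] r0 by linarith+
  have sub: "touching z \<delta> k \<subseteq> A \<inter> ball z (2 * ?r)"
  proof
    fix x assume "x \<in> touching z \<delta> k"
    then obtain e where x: "x \<in> S k" and e: "e \<in> E k x" "dist z e < \<delta>"
      unfolding touching_def by auto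
    have "dist x e < \<eta> ^ k * r0" using E_near[OF x] e by auto
    then have "dist z x < 2 * ?r"
      using e \<delta> radius_mono[OF \<open>j \<le> k\<close>] dist_triangle2[of z x e] by linarith
    then show "x \<in> A \<inter> ball z (2 * ?r)" using x S_subset by auto
  qed
  have sep: "\<eta> ^ (k - j) * ?r \<le> dist x y"
    if "x \<in> touching z \<delta> k" "y \<in> touching z \<delta> k" "x \<noteq> y" for x y
  proof -
    have "\<eta> ^ (k - j) * ?r = \<eta> ^ k * r0"
      using \<open>j \<le> k\<close> by (simp flip: mult.assoc power_add)
    moreover have "x \<in> S k" "y \<in> S k" using that by (auto simp: touching_def)
    ultimately show ?thesis using S_sep[of x k y] \<open>x \<noteq> y\<close> by (simp only: simp_thms)
  qed
  have \<eta>1: "\<eta> \<le> 1" using \<eta> by simp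
  have por: "porous_at_scale \<eta> A \<delta>'" if "0 < \<delta>'" "\<delta>' \<le> ?r" for \<delta>'
    using porous that r by simp
  show "finite (touching z \<delta> k)"
    by (rule card_separated_porous_le(1)[OF \<eta>(1) \<eta>1 r(1,2) por sub sep])
  show "real (card (touching z \<delta> k)) \<le> packing_const * (decay \<eta> * \<eta> powr (- s)) ^ (k - j)"
    unfolding packing_const_def by (rule card_separated_porous_le(2)[OF \<eta>(1) \<eta>1 r(1,2) por sub sep])
qed

lemma level_ball_le:
  assumes "j \<le> k" and \<delta>: "\<delta> \<le> \<eta> ^ j * r0" and c: "0 \<le> c"
    and le: "\<And>x. x \<in> S k \<Longrightarrow> emeasure (m k x) (ball z \<delta>) \<le> ennreal c"
  shows "emeasure (level k) (ball z \<delta>) \<le> ennreal (packing_const * (decay \<eta> * \<eta> powr (- s)) ^ (k - j) * c)"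
  unfolding level_def
proof (rule emeasure_sum_measure_le[where T = "touching z \<delta> k"])
  show "finite (touching z \<delta> k)"
    "real (card (touching z \<delta> k)) \<le> packing_const * (decay \<eta> * \<eta> powr (- s)) ^ (k - j)"
    using card_touching[OF assms(1,2)] by auto
  show "emeasure (m k x) (ball z \<delta>) = 0" if "x \<in> S k - touching z \<delta> k" for x
    using that by (intro regular_pieceD(3)[OF piece]) (auto simp: touching_def)
qed (use le c sets_m in \<open>auto simp: touching_def\<close>)

lemma level_ball_zero:
  assumes "touching z \<delta> k = {}"
  shows "emeasure (level k) (ball z \<delta>) = 0"
proof -
  have "emeasure (level k) (ball z \<delta>) \<le> ennreal (0 * 0)"
    unfolding level_def
    by (rule emeasure_sum_measure_le[where T = "{}"])
      (use assms in \<open>auto simp: touching_def sets_m intro!: regular_pieceD(3)[OF piece]\<close>)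
  then show ?thesis by simp
qed

text \<open>
  A piece of level \<open>k\<close> keeps distance \<open>\<eta> ^ Suc k * r0\<close> from \<open>A\<close>, whereas a piece of level \<open>l\<close> is within
  \<open>\<eta> ^ l * r0\<close> of \<open>A\<close>. Both can be near \<open>z\<close> only if these lengths are comparable. Consequently at most
  two levels coarser than \<open>\<delta>\<close> have pieces that meet \<open>ball z \<delta>\<close>.
\<close>

lemma touching_coarse_levels:
  assumes \<delta>: "\<delta> < \<eta> ^ j * r0" and "k < l" "l < j"
    and "touching z \<delta> k \<noteq> {}" "touching z \<delta> l \<noteq> {}"
  shows "l \<le> Suc k"
proof (rule ccontr)
  assume "\<not> l \<le> Suc k"
  obtain x e where x: "x \<in> S k" and e: "e \<in> E k x" "dist z e < \<delta>"
    using assms(4) unfolding touching_def by auto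
  obtain x' e' where x': "x' \<in> S l" and e': "e' \<in> E l x'" "dist z e' < \<delta>"
    using assms(5) unfolding touching_def by auto
  have "\<eta> ^ Suc k * r0 \<le> dist e x'"
    using E_far[OF x e(1)] x' S_subset by blast
  also have "\<dots> \<le> dist e e' + dist e' x'" by (rule dist_triangle)
  also have "dist e e' \<le> dist z e + dist z e'" by (rule dist_triangle3)
  also have "dist e' x' < \<eta> ^ l * r0"
    using E_near[OF x'] e' by (auto simp: dist_commute)
  finally have 1: "\<eta> ^ Suc k * r0 < 2 * \<delta> + \<eta> ^ l * r0" using e e' by linarith
  have step: "\<eta> ^ n' * r0 \<le> 1/4 * (\<eta> ^ n * r0)" if "n < n'" for n n'
  proof -
    have "\<eta> ^ n' * r0 \<le> \<eta> ^ Suc n * r0" using that by (intro radius_mono) simp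
    also have "\<dots> = \<eta> * (\<eta> ^ n * r0)" by simp
    also have "\<dots> \<le> 1/4 * (\<eta> ^ n * r0)"
      using \<eta> radius_pos[of n] by (intro mult_right_mono) auto
    finally show ?thesis .
  qed
  have "\<eta> ^ j * r0 \<le> 1/4 * (\<eta> ^ l * r0)" "\<eta> ^ l * r0 \<le> 1/4 * (\<eta> ^ Suc k * r0)"
    using step[OF \<open>l < j\<close>] step[of "Suc k" l] \<open>\<not> l \<le> Suc k\<close> by (simp_all only: not_le)
  with 1 \<delta> radius_pos[of "Suc k"] show False by linarith
qed

text \<open>
  From each level to the next the number of pieces in a fixed ball grows at most by the factor
  \<open>decay \<eta> * \<eta> powr (- s)\<close>, while the mass of a single piece changes by \<open>\<eta> powr t\<close>.
\<close>

definition level_ratio :: real where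
  "level_ratio = decay \<eta> * \<eta> powr (- s) * \<eta> powr t"

lemma level_ratio_bounds: "0 \<le> level_ratio" "level_ratio < 1"
  using ratio decay_bounds[of \<eta>] \<eta> by (auto simp: level_ratio_def)

text \<open>
  The first summand comes from the at most two coarse levels, the second one from the geometric
  series over the fine levels.
\<close>

definition upper_const :: real where
  "upper_const = 2 * packing_const * \<beta> + packing_const * \<eta> powr (- t) / (1 - level_ratio)"

lemma \<nu>_ball_le:
  assumes \<delta>: "0 < \<delta>" "\<delta> < r0"
  shows "emeasure \<nu> (ball z \<delta>) \<le> ennreal (upper_const * \<delta> powr t)"
proof -
  obtain j where j: "\<eta> ^ Suc j * r0 \<le> \<delta>" "\<delta> < \<eta> ^ j * r0"
    using geometric_scale[of \<eta> \<delta> r0] \<eta> \<delta> by auto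
  let ?L = "\<lambda>k. emeasure (level k) (ball z \<delta>)"
  let ?r = "\<eta> ^ j * r0"
  have coarse: "?L k \<le> ennreal (packing_const * (\<beta> * \<delta> powr t))" if "k < j" for k
  proof -
    have "?L k \<le> ennreal (packing_const * (decay \<eta> * \<eta> powr (- s)) ^ (k - k) * (\<beta> * \<delta> powr t))"
    proof (rule level_ball_le)
      show "\<delta> \<le> \<eta> ^ k * r0" using radius_mono[of k j] that j(2) by linarith
    qed (use \<beta> \<delta> in \<open>auto intro: regular_pieceD(5)[OF piece]\<close>)
    then show ?thesis by simp
  qed
  have fine: "?L k \<le> ennreal (packing_const * ?r powr t * level_ratio ^ (k - j))" if "j \<le> k" for k
  proof -
    have "?L k \<le> ennreal (packing_const * (decay \<eta> * \<eta> powr (- s)) ^ (k - j) * (\<eta> ^ k * r0) powr t)"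
    proof (rule level_ball_le[OF that])
      fix x assume "x \<in> S k"
      then have "emeasure (m k x) (ball z \<delta>) \<le> ennreal ((\<eta> ^ Suc k * r0) powr t)"
        by (intro regular_piece_total_le(1)[OF piece]) auto
      also have "\<dots> \<le> ennreal ((\<eta> ^ k * r0) powr t)"
        using radius_mono[of k "Suc k"] radius_pos[of "Suc k"] t_pos
        by (intro ennreal_leI powr_mono2) auto
      finally show "emeasure (m k x) (ball z \<delta>) \<le> ennreal ((\<eta> ^ k * r0) powr t)" .
    qed (use j in auto)
    also have "\<eta> ^ k * r0 = \<eta> ^ (k - j) * ?r"
      using that by (simp flip: mult.assoc power_add)
    also have "(\<eta> ^ (k - j) * ?r) powr t = (\<eta> powr t) ^ (k - j) * ?r powr t"
      using \<eta> radius_pos[of j]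
      by (simp add: powr_mult powr_powr mult.commute flip: powr_realpow)
    finally show ?thesis by (simp add: level_ratio_def power_mult_distrib mult_ac)
  qed
  let ?K = "{k. k < j \<and> touching z \<delta> k \<noteq> {}}"
  have cardK: "card ?K \<le> 2"
    by (rule card_le_2_if_neighbours) (use touching_coarse_levels[OF j(2)] in auto)
  have K: "(\<Sum>k<j. ?L k) \<le> ennreal (2 * (packing_const * (\<beta> * \<delta> powr t)))"
  proof -
    have "(\<Sum>k<j. ?L k) = (\<Sum>k\<in>?K. ?L k)"
      by (rule sum.mono_neutral_right) (auto intro: level_ball_zero)
    also have "\<dots> \<le> (\<Sum>k\<in>?K. ennreal (packing_const * (\<beta> * \<delta> powr t)))"
      by (intro sum_mono coarse) simp
    also have "\<dots> = ennreal (real (card ?K) * (packing_const * (\<beta> * \<delta> powr t)))"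
      using packing_const_pos \<beta> by (simp add: ennreal_mult ennreal_of_nat_eq_real_of_nat)
    also have "\<dots> \<le> ennreal (2 * (packing_const * (\<beta> * \<delta> powr t)))"
      using cardK packing_const_pos \<beta> by (intro ennreal_leI mult_right_mono) auto
    finally show ?thesis .
  qed
  have F: "(\<Sum>k\<in>{j..<n}. ?L k) \<le> ennreal (packing_const * (\<eta> powr (- t) * \<delta> powr t) * (1 / (1 - level_ratio)))" for n
  proof -
    have "(\<Sum>k\<in>{j..<n}. ?L k) \<le> (\<Sum>k\<in>{j..<n}. ennreal (packing_const * ?r powr t * level_ratio ^ (k - j)))"
      by (intro sum_mono fine) simp
    also have "\<dots> = ennreal (packing_const * ?r powr t * (\<Sum>k\<in>{j..<n}. level_ratio ^ (k - j)))"
      using packing_const_pos level_ratio_bounds by (subst sum_ennreal) (auto simp: sum_distrib_left)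
    also have "\<dots> \<le> ennreal (packing_const * ?r powr t * (1 / (1 - level_ratio)))"
      using packing_const_pos level_ratio_bounds by (intro ennreal_leI mult_left_mono sum_shifted_powers_le) auto
    also have "\<dots> \<le> ennreal (packing_const * (\<eta> powr (- t) * \<delta> powr t) * (1 / (1 - level_ratio)))"
    proof (intro ennreal_leI mult_right_mono mult_left_mono)
      have "?r powr t \<le> (\<delta> / \<eta>) powr t"
        using j(1) radius_pos[of j] \<eta> t_pos by (intro powr_mono2) (auto simp: field_simps)
      also have "\<dots> = \<eta> powr (- t) * \<delta> powr t"
        using \<eta> \<delta> by (simp add: powr_divide powr_minus field_simps)
      finally show "?r powr t \<le> \<eta> powr (- t) * \<delta> powr t" .
    qed (use packing_const_pos level_ratio_bounds in auto)
    finally show ?thesis .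
  qed
  have "(\<Sum>k<n. ?L k) \<le> ennreal (upper_const * \<delta> powr t)" for n
  proof -
    have "(\<Sum>k<n. ?L k) \<le> (\<Sum>k\<in>{..<j} \<union> {j..<n}. ?L k)"
      by (rule sum_mono2) auto
    also have "\<dots> = (\<Sum>k<j. ?L k) + (\<Sum>k\<in>{j..<n}. ?L k)"
      by (rule sum.union_disjoint) auto
    also have "\<dots> \<le> ennreal (2 * (packing_const * (\<beta> * \<delta> powr t)))
        + ennreal (packing_const * (\<eta> powr (- t) * \<delta> powr t) * (1 / (1 - level_ratio)))"
      by (rule add_mono[OF K F])
    also have "\<dots> = ennreal (upper_const * \<delta> powr t)"
      using packing_const_pos \<beta> level_ratio_bounds
      by (subst ennreal_plus[symmetric]) (auto simp: upper_const_def algebra_simps)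
    finally show ?thesis .
  qed
  then show ?thesis
    by (simp add: emeasure_\<nu> suminf_le_const)
qed

text \<open>
  A ball about a point of \<open>A\<close> contains a point of the net of comparable scale together with the entire
  piece that belongs to it.
\<close>

lemma \<nu>_ball_ge_base:
  assumes x: "x \<in> A" and \<delta>: "0 < \<delta>" "\<delta> < 2 * r0"
  shows "ennreal ((\<eta>\<^sup>2 / 2 * \<delta>) powr t) \<le> emeasure \<nu> (ball x \<delta>)"
proof -
  obtain j where j: "\<eta> ^ Suc j * (2 * r0) \<le> \<delta>" "\<delta> < \<eta> ^ j * (2 * r0)"
    using geometric_scale[of \<eta> \<delta> "2 * r0"] \<eta> \<delta> by auto
  obtain x' where x': "x' \<in> S (Suc j)" "dist x x' < \<eta> ^ Suc j * r0"
    using S_net[OF x] by blast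
  have sub: "E (Suc j) x' \<subseteq> ball x \<delta>"
  proof
    fix e assume "e \<in> E (Suc j) x'"
    then have "dist x' e < \<eta> ^ Suc j * r0" using E_near[OF x'(1)] by auto
    moreover have "dist x e \<le> dist x x' + dist x' e" by (rule dist_triangle)
    ultimately show "e \<in> ball x \<delta>" using x' j(1) by auto
  qed
  have "(\<eta>\<^sup>2 / 2 * \<delta>) powr t \<le> (\<eta> ^ Suc (Suc j) * r0) powr t"
  proof (rule powr_mono2)
    have "\<eta>\<^sup>2 / 2 * \<delta> \<le> \<eta>\<^sup>2 / 2 * (\<eta> ^ j * (2 * r0))"
      using j(2) by (intro mult_left_mono) auto
    then show "\<eta>\<^sup>2 / 2 * \<delta> \<le> \<eta> ^ Suc (Suc j) * r0"
      by (simp add: power2_eq_square mult_ac)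
  qed (use t_pos \<delta> in auto)
  then have "ennreal ((\<eta>\<^sup>2 / 2 * \<delta>) powr t) \<le> ennreal ((\<eta> ^ Suc (Suc j) * r0) powr t)"
    by (rule ennreal_leI)
  also have "\<dots> \<le> emeasure (m (Suc j) x') (ball x \<delta>)"
    using sub by (intro regular_piece_total_le(2)[OF piece[OF x'(1)]]) auto
  also have "\<dots> \<le> emeasure \<nu> (ball x \<delta>)"
    using x' by (intro piece_le_\<nu>) auto
  finally show ?thesis .
qed

definition lower_const :: real where
  "lower_const = min ((\<eta>\<^sup>2 / 4) powr t) (\<alpha> * \<eta> powr t)"

lemma lower_const_pos: "0 < lower_const"
  using \<eta> \<alpha> by (simp add: lower_const_def)

text \<open>
  At a point \<open>z\<close> of the piece at \<open>x\<close>, balls that are large compared with the piece contain the ball of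
  half the radius about the point \<open>x\<close> of \<open>A\<close>; in smaller balls the piece itself has enough mass.
\<close>

lemma \<nu>_ball_ge:
  assumes z: "z \<in> A \<union> (\<Union>k. \<Union>x\<in>S k. E k x)" and \<delta>: "0 < \<delta>" "\<delta> < r0"
  shows "ennreal (lower_const * \<delta> powr t) \<le> emeasure \<nu> (ball z \<delta>)"
proof -
  have base: "ennreal (lower_const * \<delta> powr t) \<le> emeasure \<nu> (ball z \<delta>)"
    if x: "x \<in> A" and sub: "ball x (\<delta> / 2) \<subseteq> ball z \<delta>" for x
  proof -
    have "lower_const * \<delta> powr t \<le> (\<eta>\<^sup>2 / 4) powr t * \<delta> powr t"
      by (intro mult_right_mono) (auto simp: lower_const_def)
    also have "\<dots> = (\<eta>\<^sup>2 / 2 * (\<delta> / 2)) powr t"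
      using \<eta> \<delta> by (simp flip: powr_mult)
    finally have "ennreal (lower_const * \<delta> powr t) \<le> ennreal ((\<eta>\<^sup>2 / 2 * (\<delta> / 2)) powr t)"
      by (rule ennreal_leI)
    also have "\<dots> \<le> emeasure \<nu> (ball x (\<delta> / 2))"
      using x \<delta> r0 by (intro \<nu>_ball_ge_base) auto
    also have "\<dots> \<le> emeasure \<nu> (ball z \<delta>)"
      using sub by (intro emeasure_mono) (auto simp: \<nu>_def)
    finally show ?thesis .
  qed
  show ?thesis
  proof (cases "z \<in> A")
    case True
    then show ?thesis using \<delta> by (intro base[OF True] subset_ball) simp
  next
    case False
    with z obtain k x where x: "x \<in> S k" and zE: "z \<in> E k x" by blast
    have xz: "dist x z < \<eta> ^ k * r0" using E_near[OF x] zE by auto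
    show ?thesis
    proof (cases "2 * (\<eta> ^ k * r0) \<le> \<delta>")
      case True
      have "ball x (\<delta> / 2) \<subseteq> ball z \<delta>"
      proof
        fix p assume "p \<in> ball x (\<delta> / 2)"
        then show "p \<in> ball z \<delta>" using xz True dist_triangle3[of z p x] by auto
      qed
      with x S_subset show ?thesis by (intro base) auto
    next
      case False
      have "lower_const * \<delta> powr t \<le> \<alpha> * \<eta> powr t * \<delta> powr t"
        by (intro mult_right_mono) (auto simp: lower_const_def)
      also have "\<dots> = \<alpha> * (\<eta> * \<delta>) powr t"
        using \<eta> \<delta> by (simp add: powr_mult)
      finally have "ennreal (lower_const * \<delta> powr t) \<le> ennreal (\<alpha> * (\<eta> * \<delta>) powr t)"
        by (rule ennreal_leI)
      also have "\<dots> \<le> emeasure (m k x) (ball z (\<eta> * \<delta>))"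
      proof (rule regular_pieceD(6)[OF piece[OF x] zE])
        show "0 < \<eta> * \<delta>" using \<eta> \<delta> by simp
        have "\<eta> * \<delta> < \<eta> * (2 * (\<eta> ^ k * r0))"
          using False \<eta> by (intro mult_strict_left_mono) auto
        then show "\<eta> * \<delta> < 2 * (\<eta> ^ Suc k * r0)" by (simp add: mult_ac)
      qed
      also have "\<dots> \<le> emeasure \<nu> (ball z (\<eta> * \<delta>))"
        using x by (intro piece_le_\<nu>) auto
      also have "\<dots> \<le> emeasure \<nu> (ball z \<delta>)"
      proof (intro emeasure_mono subset_ball)
        show "\<eta> * \<delta> \<le> \<delta>" using \<eta> \<delta> mult_right_mono[of \<eta> 1 \<delta>] by simp
      qed (simp add: \<nu>_def)
      finally show ?thesis .
    qed
  qed
qed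

text \<open>
  The closure makes the superset a Borel set, so that the outer measure of its complement is the
  measure of an open set disjoint from all pieces.
\<close>

lemma regular_superset: "\<exists>F. regular_set t F \<and> A \<subseteq> F"
proof (intro exI conjI)
  let ?D = "A \<union> (\<Union>k. \<Union>x\<in>S k. E k x)"
  show "A \<subseteq> closure ?D" using closure_subset[of ?D] by blast
  show "regular_set t (closure ?D)"
    unfolding regular_set_def
  proof (intro exI[of _ \<nu>] conjI)
    show "sets \<nu> = sets borel" by (simp add: \<nu>_def)
    have "emeasure \<nu> (UNIV - closure ?D) = 0"
    proof -
      have "emeasure (level k) (UNIV - closure ?D) = 0" for k
      proof -
        have "emeasure (level k) (UNIV - closure ?D) \<le> ennreal (0 * 0)"
          unfolding level_def
        proof (rule emeasure_sum_measure_le[where T = "{}"])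
          fix x assume "x \<in> S k - {}"
          then have x: "x \<in> S k" by simp
          then have "E k x \<subseteq> ?D" by blast
          then have "E k x \<subseteq> closure ?D" using closure_subset by (rule order_trans)
          then show "emeasure (m k x) (UNIV - closure ?D) = 0"
            by (intro regular_pieceD(3)[OF piece[OF x]]) auto
        qed (auto simp: sets_m)
        then show ?thesis by simp
      qed
      then show ?thesis by (simp add: emeasure_\<nu>)
    qed
    then show "outer_measure_of \<nu> (UNIV - closure ?D) = 0"
      by (subst outer_measure_of_eq) (auto simp: \<nu>_def)
    show "regular_on t \<nu> (closure ?D)"
      unfolding regular_on_def
    proof (intro exI conjI ballI allI impI)
      let ?c = "lower_const * (1 / 2) powr t"
      show "0 < ?c" using lower_const_pos by simp
      show "?c \<le> max ?c upper_const" by simp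
      show "0 < r0" by (rule r0)
      fix z r assume z: "z \<in> closure ?D" and r: "0 < r \<and> r < r0"
      obtain z' where z': "z' \<in> ?D" "dist z' z < r / 2"
        using z r half_gt_zero[of r] unfolding closure_approachable by blast
      have "ennreal (?c * r powr t) = ennreal (lower_const * (r / 2) powr t)"
        using r powr_mult[of "1/2" r t] by (simp add: mult.assoc)
      also have "\<dots> \<le> emeasure \<nu> (ball z' (r / 2))"
        using z'(1) r by (intro \<nu>_ball_ge) auto
      also have "\<dots> \<le> emeasure \<nu> (ball z r)"
      proof (rule emeasure_mono)
        show "ball z' (r / 2) \<subseteq> ball z r"
        proof
          fix p assume "p \<in> ball z' (r / 2)"
          then show "p \<in> ball z r" using z' dist_triangle3[of z p z'] by auto
        qed
      qed (simp add: \<nu>_def)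
      finally show "ennreal (?c * r powr t) \<le> emeasure \<nu> (ball z r)" .
      have "emeasure \<nu> (ball z r) \<le> ennreal (upper_const * r powr t)"
        using r by (intro \<nu>_ball_le) auto
      also have "\<dots> \<le> ennreal (max ?c upper_const * r powr t)"
        by (intro ennreal_leI mult_right_mono) auto
      finally show "emeasure \<nu> (ball z r) \<le> ennreal (max ?c upper_const * r powr t)" .
    qed
  qed
qed

end

section \<open>Porosity and regular supersets\<close>

lemma less_por_iff:
  assumes "0 \<le> \<rho>"
  shows "ereal \<rho> < por A x r \<longleftrightarrow> (\<exists>\<rho>'>\<rho>. \<exists>y. ball y (\<rho>' * r) \<subseteq> ball x r - A)"
proof -
  have "ereal \<rho> < por A x r \<longleftrightarrow>
      (\<exists>\<rho>'. 0 \<le> \<rho>' \<and> (\<exists>y. ball y (\<rho>' * r) \<subseteq> ball x r - A) \<and> \<rho> < \<rho>')"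
    unfolding por_def less_SUP_iff by auto
  also have "\<dots> \<longleftrightarrow> (\<exists>\<rho>'>\<rho>. \<exists>y. ball y (\<rho>' * r) \<subseteq> ball x r - A)"
    using assms less_imp_le[OF le_less_trans[OF assms]] by blast
  finally show ?thesis .
qed

context regular_space
begin

lemma regular_superset_if_porous:
  fixes A :: "'a set"
  assumes \<rho>: "0 < \<rho>" and porous: "uniformly_porous \<rho> A"
  shows "\<exists>t F. 0 < t \<and> t < s \<and> regular_set t F \<and> A \<subseteq> F"
proof -
  obtain R' where R': "0 < R'" "\<And>x r. x \<in> A \<Longrightarrow> 0 < r \<Longrightarrow> r < R' \<Longrightarrow> ereal \<rho> < por A x r"
    using porous unfolding uniformly_porous_def by blast
  define \<eta> where "\<eta> = min (\<rho> / 2) (1 / 4)"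
  have \<eta>: "0 < \<eta>" "\<eta> \<le> 1/4" "2 * \<eta> \<le> \<rho>" using \<rho> by (auto simp: \<eta>_def)
  define r0 where "r0 = min R R' / 4"
  have r0: "0 < r0" "3 * r0 < R" "r0 < R'" using R_pos R' by (auto simp: r0_def)
  have scale: "porous_at_scale \<eta> A \<delta>" if \<delta>: "0 < \<delta>" "\<delta> \<le> r0" for \<delta>
    unfolding porous_at_scale_def
  proof
    fix x assume "x \<in> A"
    then have "ereal \<rho> < por A x \<delta>" using R'(2) \<delta> r0 by simp
    then obtain \<rho>' y where \<rho>': "\<rho> < \<rho>'" and y: "ball y (\<rho>' * \<delta>) \<subseteq> ball x \<delta> - A"
      using \<rho> by (auto simp: less_por_iff)
    have "2 * \<eta> * \<delta> \<le> \<rho>' * \<delta>" using \<rho>' \<eta> \<delta> by (intro mult_right_mono) auto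
    then have "ball y (2 * (\<eta> * \<delta>)) \<subseteq> ball y (\<rho>' * \<delta>)" by (intro subset_ball) simp
    with y show "\<exists>y. ball y (2 * (\<eta> * \<delta>)) \<subseteq> ball x \<delta> - A" by blast
  qed
  have \<theta>: "0 < decay \<eta>" "decay \<eta> < 1" using decay_bounds[of \<eta>] \<eta> by auto
  \<comment> \<open>At \<open>t = s\<close> the ratio is \<open>decay \<eta> < 1\<close>, and it depends continuously on \<open>t\<close>.\<close>
  have "((\<lambda>t. decay \<eta> * \<eta> powr (t - s)) \<longlongrightarrow> decay \<eta> * \<eta> powr (s - s)) (at_left s)"
    by (intro tendsto_intros) (use \<eta> in auto)
  then have "\<forall>\<^sub>F t in at_left s. decay \<eta> * \<eta> powr (t - s) < 1"
    using \<eta> \<theta> by (intro order_tendstoD(2)) auto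
  moreover have "\<forall>\<^sub>F t in at_left s. t \<in> {0<..<s}"
    by (rule eventually_at_left_real[OF s_pos])
  ultimately have "\<forall>\<^sub>F t in at_left s. decay \<eta> * \<eta> powr (t - s) < 1 \<and> t \<in> {0<..<s}"
    by (rule eventually_conj)
  from eventually_happens'[OF trivial_limit_at_left_real this]
  obtain t where "decay \<eta> * \<eta> powr (t - s) < 1" and t: "0 < t" "t < s"
    by auto
  then have ratio: "decay \<eta> * \<eta> powr (- s) * \<eta> powr t < 1"
    by (simp add: mult.assoc flip: powr_add)
  obtain \<alpha> \<beta> where \<alpha>: "0 < \<alpha>" and \<beta>: "0 < \<beta>"
    and pieces: "\<And>y r. 0 < r \<Longrightarrow> r < R \<Longrightarrow> \<exists>m E. regular_piece t \<alpha> \<beta> (y::'a) r m E"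
    using exists_regular_piece[OF t] by blast
  have pos: "0 < \<eta> ^ k * r0" and le: "\<eta> ^ k * r0 \<le> r0" for k
    using \<eta> r0 mult_right_mono[OF power_le_one[of \<eta> k], of r0] by auto
  have "\<exists>S\<subseteq>A. (\<forall>x\<in>S. \<forall>x'\<in>S. x \<noteq> x' \<longrightarrow> \<eta> ^ k * r0 \<le> dist x x') \<and>
      (\<forall>x\<in>A. \<exists>x'\<in>S. dist x x' < \<eta> ^ k * r0)" for k
    by (rule maximal_separated_subset[OF pos])
  then have "\<exists>S. \<forall>k. S k \<subseteq> A \<and>
      (\<forall>x\<in>S k. \<forall>x'\<in>S k. x \<noteq> x' \<longrightarrow> \<eta> ^ k * r0 \<le> dist x x') \<and>
      (\<forall>x\<in>A. \<exists>x'\<in>S k. dist x x' < \<eta> ^ k * r0)"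
    by (intro choice allI)
  then obtain S where S_all: "\<forall>k. S k \<subseteq> A \<and>
      (\<forall>x\<in>S k. \<forall>x'\<in>S k. x \<noteq> x' \<longrightarrow> \<eta> ^ k * r0 \<le> dist x x') \<and>
      (\<forall>x\<in>A. \<exists>x'\<in>S k. dist x x' < \<eta> ^ k * r0)"
    by (rule exE)
  then have S: "\<And>k. S k \<subseteq> A"
    "\<And>k x x'. x \<in> S k \<Longrightarrow> x' \<in> S k \<Longrightarrow> x \<noteq> x' \<Longrightarrow> \<eta> ^ k * r0 \<le> dist x x'"
    "\<And>k x. x \<in> A \<Longrightarrow> \<exists>x'\<in>S k. dist x x' < \<eta> ^ k * r0"
    by auto
  have "\<exists>y. x \<in> A \<longrightarrow> ball y (2 * (\<eta> ^ Suc k * r0)) \<subseteq> ball x (\<eta> ^ k * r0) - A" for k x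
    using scale[OF pos le, of k] unfolding porous_at_scale_def by (simp add: mult.assoc)
  then have "\<exists>pore. \<forall>k x. x \<in> A \<longrightarrow>
      ball (pore k x) (2 * (\<eta> ^ Suc k * r0)) \<subseteq> ball x (\<eta> ^ k * r0) - A"
    by (intro choice allI)
  then obtain pore where pore: "\<And>k x. x \<in> A \<Longrightarrow>
      ball (pore k x) (2 * (\<eta> ^ Suc k * r0)) \<subseteq> ball x (\<eta> ^ k * r0) - A"
    by auto
  have "\<exists>m E. regular_piece t \<alpha> \<beta> (pore k x) (\<eta> ^ Suc k * r0) m E" for k x
  proof (rule pieces[OF pos])
    show "\<eta> ^ Suc k * r0 < R" using le[of "Suc k"] r0 by linarith
  qed
  then have "\<exists>m. \<forall>k x. \<exists>E. regular_piece t \<alpha> \<beta> (pore k x) (\<eta> ^ Suc k * r0) (m k x) E"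
    by (intro choice allI)
  then obtain m where "\<And>k x. \<exists>E. regular_piece t \<alpha> \<beta> (pore k x) (\<eta> ^ Suc k * r0) (m k x) E"
    by auto
  then have "\<exists>E. \<forall>k x. regular_piece t \<alpha> \<beta> (pore k x) (\<eta> ^ Suc k * r0) (m k x) (E k x)"
    by (intro choice allI)
  then obtain E where piece: "\<And>k x. regular_piece t \<alpha> \<beta> (pore k x) (\<eta> ^ Suc k * r0) (m k x) (E k x)"
    by auto
  interpret pore_filling \<mu> s a b R A \<eta> r0 t \<alpha> \<beta> S pore m E
  proof unfold_locales
    show "ball (pore k x) (2 * (\<eta> ^ Suc k * r0)) \<subseteq> ball x (\<eta> ^ k * r0) - A" if "x \<in> S k" for k x
      by (rule pore) (use S(1) that in blast)
    show "regular_piece t \<alpha> \<beta> (pore k x) (\<eta> ^ Suc k * r0) (m k x) (E k x)" for k x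
      by (rule piece)
  qed (fact \<eta>(1) \<eta>(2) r0(1) r0(2) t(1) \<alpha> \<beta> scale ratio S)+
  show ?thesis using regular_superset t by blast
qed

text \<open>
  For small \<open>\<epsilon>\<close> the number of points that fit into a ball of the \<open>s\<close>-regular space exceeds any
  multiple of the number allowed by a \<open>t\<close>-regular measure.
\<close>

lemma exists_packing_number:
  assumes t: "0 < t" "t < s" and K: "0 \<le> K"
  obtains \<epsilon> N where "0 < \<epsilon>" "\<epsilon> < 1" "real N * (b * \<epsilon> powr s) \<le> a" "K * \<epsilon> powr (- t) < real N"
proof -
  define c where "c = a / b"
  have c: "0 < c" using a_pos b_pos by (simp add: c_def)
  define \<epsilon> where "\<epsilon> = min (1 / 2) ((c / (K + 1)) powr (1 / (s - t)))"
  have \<epsilon>: "0 < \<epsilon>" "\<epsilon> < 1" using c K by (auto simp: \<epsilon>_def)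
  define N where "N = nat \<lfloor>c * \<epsilon> powr (- s)\<rfloor>"
  have N: "real N \<le> c * \<epsilon> powr (- s)" "c * \<epsilon> powr (- s) < real N + 1"
    using c by (auto simp: N_def)
  have "real N * (b * \<epsilon> powr s) \<le> c * \<epsilon> powr (- s) * (b * \<epsilon> powr s)"
    using N b_pos by (intro mult_right_mono) auto
  also have "\<dots> = a" using b_pos \<epsilon> by (simp add: c_def powr_minus)
  finally have 1: "real N * (b * \<epsilon> powr s) \<le> a" .
  have "\<epsilon> powr (s - t) \<le> ((c / (K + 1)) powr (1 / (s - t))) powr (s - t)"
    using \<epsilon> t by (intro powr_mono2) (auto simp: \<epsilon>_def)
  also have "\<dots> = c / (K + 1)" using c K t by (simp add: powr_powr)
  finally have "(K + 1) * \<epsilon> powr (s - t) \<le> c" using K by (simp add: field_simps)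
  then have "(K + 1) * \<epsilon> powr (s - t) * \<epsilon> powr (- s) \<le> c * \<epsilon> powr (- s)"
    by (intro mult_right_mono) auto
  moreover have "\<epsilon> powr (s - t) * \<epsilon> powr (- s) = \<epsilon> powr (- t)"
    by (simp flip: powr_add)
  ultimately have "(K + 1) * \<epsilon> powr (- t) \<le> c * \<epsilon> powr (- s)" by (simp add: mult.assoc)
  moreover have "1 \<le> \<epsilon> powr (- t)"
    using powr_mono'[of "- t" 0 \<epsilon>] \<epsilon> t by simp
  ultimately have "K * \<epsilon> powr (- t) < real N" using N(2) by (simp add: algebra_simps)
  with \<epsilon> 1 show ?thesis by (rule that)
qed

lemma porous_if_regular_superset:
  assumes t: "0 < t" "t < s" and F: "regular_set t F" and "A \<subseteq> F"
  shows "\<exists>\<rho>>0. uniformly_porous \<rho> (A :: 'a set)"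
proof -
  obtain \<nu> a' b' R' where sets_\<nu>: "sets \<nu> = sets borel"
    and a': "0 < a'" "a' \<le> b'" and R': "0 < R'"
    and lower': "\<And>x r. x \<in> F \<Longrightarrow> 0 < r \<Longrightarrow> r < R' \<Longrightarrow> ennreal (a' * r powr t) \<le> emeasure \<nu> (ball x r)"
    and upper': "\<And>x r. x \<in> F \<Longrightarrow> 0 < r \<Longrightarrow> r < R' \<Longrightarrow> emeasure \<nu> (ball x r) \<le> ennreal (b' * r powr t)"
    using F unfolding regular_set_def regular_on_def by blast
  \<comment> \<open>The factor 8 is due to the balls of radius \<open>\<epsilon> / 8 * r\<close> used below.\<close>
  obtain \<epsilon> N where \<epsilon>: "0 < \<epsilon>" "\<epsilon> < 1" and N: "real N * (b * \<epsilon> powr s) \<le> a"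
      "b' / a' * 8 powr t * \<epsilon> powr (- t) < real N"
    using exists_packing_number[OF t, of "b' / a' * 8 powr t"] a' by auto
  have "ereal (\<epsilon> / 16) < por A x r" if x: "x \<in> A" and r: "0 < r" "r < min R R'" for x r
  proof -
    have r2: "0 < r / 2" "r / 2 < R" using r by auto
    obtain f where f: "\<And>i. i < N \<Longrightarrow> f i \<in> ball x (r / 2)"
      and sep: "\<And>i j. i < N \<Longrightarrow> j < N \<Longrightarrow> i \<noteq> j \<Longrightarrow> \<epsilon> * (r / 2) \<le> dist (f i) (f j)"
      using separated_points[OF r2 \<epsilon> N(1)] by blast
    define \<delta> where "\<delta> = \<epsilon> / 8 * r"
    have "\<delta> = \<epsilon> * r / 8" "0 < \<epsilon> * r" "\<epsilon> * r \<le> r" "r < R'"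
      using \<epsilon> r by (auto simp: \<delta>_def)
    then have \<delta>: "0 < \<delta>" "8 * \<delta> \<le> r" "\<delta> < R'" "\<epsilon> * (r / 2) = 4 * \<delta>"
      by (linarith, linarith, linarith, simp)
    have near: "ball z \<delta> \<subseteq> ball x r" if "i < N" "dist (f i) z < \<delta>" for i z
    proof
      fix p assume "p \<in> ball z \<delta>"
      moreover have "dist x p \<le> dist x (f i) + dist (f i) z + dist z p"
        using dist_triangle[of x p "f i"] dist_triangle[of "f i" p z] by linarith
      moreover have "dist x (f i) < r / 2" using f[OF that(1)] by simp
      ultimately show "p \<in> ball x r" using that \<delta> r by simp
    qed
    have "\<exists>i<N. ball (f i) \<delta> \<inter> A = {}"
    proof (rule ccontr)
      assume "\<not> ?thesis"
      then have "\<forall>i\<in>{..<N}. \<exists>z. z \<in> ball (f i) \<delta> \<inter> A" by blast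
      from bchoice[OF this]
      obtain z where z: "\<And>i. i < N \<Longrightarrow> z i \<in> A" "\<And>i. i < N \<Longrightarrow> dist (f i) (z i) < \<delta>"
        by auto
      have disj: "disjoint_family_on (\<lambda>i. ball (z i) \<delta>) {..<N}"
        unfolding disjoint_family_on_def
      proof (intro ballI impI disjoint_ballI)
        fix i j assume ij: "i \<in> {..<N}" "j \<in> {..<N}" "i \<noteq> j"
        then have "4 * \<delta> \<le> dist (f i) (f j)" using sep \<delta>(4) by simp
        moreover have "dist (f i) (f j) \<le> dist (f i) (z i) + dist (z i) (z j) + dist (f j) (z j)"
          using dist_triangle[of "f i" "f j" "z i"] dist_triangle2[of "z i" "f j" "z j"] by linarith
        moreover have "dist (f i) (z i) < \<delta>" "dist (f j) (z j) < \<delta>" using z ij by auto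
        ultimately show "\<delta> + \<delta> \<le> dist (z i) (z j)" by linarith
      qed
      have "ennreal (real N * (a' * \<delta> powr t)) = (\<Sum>i<N. ennreal (a' * \<delta> powr t))"
        using a' by (simp add: ennreal_mult ennreal_of_nat_eq_real_of_nat)
      also have "\<dots> \<le> (\<Sum>i<N. emeasure \<nu> (ball (z i) \<delta>))"
        using z \<open>A \<subseteq> F\<close> \<delta> by (intro sum_mono lower') auto
      also have "\<dots> = emeasure \<nu> (\<Union>i<N. ball (z i) \<delta>)"
        by (rule sum_emeasure[OF _ disj]) (auto simp: sets_\<nu>)
      also have "\<dots> \<le> emeasure \<nu> (ball x r)"
      proof (rule emeasure_mono)
        show "(\<Union>i<N. ball (z i) \<delta>) \<subseteq> ball x r" using near z(2) by blast
      qed (simp add: sets_\<nu>)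
      also have "\<dots> \<le> ennreal (b' * r powr t)"
        using x \<open>A \<subseteq> F\<close> r by (intro upper') auto
      finally have "real N * (a' * \<delta> powr t) \<le> b' * r powr t"
        using a' by (simp add: ennreal_le_iff)
      moreover have "8 powr t * \<epsilon> powr (- t) * \<delta> powr t = r powr t"
        using \<epsilon> r by (simp add: \<delta>_def powr_mult powr_divide powr_minus)
      ultimately have "real N * (a' * \<delta> powr t) \<le> (b' / a' * 8 powr t * \<epsilon> powr (- t)) * (a' * \<delta> powr t)"
        using a' by (simp add: mult_ac)
      also have "\<dots> < real N * (a' * \<delta> powr t)"
        using N(2) a' \<delta> by (intro mult_strict_right_mono) auto
      finally show False by simp
    qed
    then obtain i where i: "i < N" "ball (f i) \<delta> \<inter> A = {}" by blast
    have "ball (f i) \<delta> \<subseteq> ball x r" using near[OF i(1), of "f i"] \<delta> by simp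
    with i have "ball (f i) (\<epsilon> / 8 * r) \<subseteq> ball x r - A" unfolding \<delta>_def by blast
    moreover have "\<epsilon> / 16 < \<epsilon> / 8" using \<epsilon> by simp
    ultimately have "\<exists>\<rho>'>\<epsilon> / 16. \<exists>y. ball y (\<rho>' * r) \<subseteq> ball x r - A" by blast
    then show ?thesis using \<epsilon> by (subst less_por_iff) auto
  qed
  then have "uniformly_porous (\<epsilon> / 16) A"
    unfolding uniformly_porous_def using R_pos R' by (intro exI[of _ "min R R'"]) auto
  then show ?thesis using \<epsilon> by (intro exI[of _ "\<epsilon> / 16"]) auto
qed

end

theorem theorem1p1:
  fixes s :: real and A :: "'a::polish_space set"
  assumes "s > 0"
    and "regular_set s (UNIV :: 'a set)"
  shows "(\<exists>\<rho>>0. uniformly_porous \<rho> A) \<longleftrightarrow>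
         (\<exists>t F. 0 < t \<and> t < s \<and> regular_set t F \<and> A \<subseteq> F)"
proof -
  obtain \<mu> :: "'a measure" and a b R where \<mu>: "sets \<mu> = sets borel" "0 < a" "a \<le> b" "0 < R"
    and ball: "\<And>x r. 0 < r \<Longrightarrow> r < R \<Longrightarrow> ennreal (a * r powr s) \<le> emeasure \<mu> (ball x r)"
    "\<And>x r. 0 < r \<Longrightarrow> r < R \<Longrightarrow> emeasure \<mu> (ball x r) \<le> ennreal (b * r powr s)"
    using assms(2) unfolding regular_set_def regular_on_def by auto
  interpret regular_space \<mu> s a b R
    by (rule regular_space.intro) (fact assms(1) \<mu> ball)+
  show ?thesis
  proof
    assume "\<exists>\<rho>>0. uniformly_porous \<rho> A"
    then show "\<exists>t F. 0 < t \<and> t < s \<and> regular_set t F \<and> A \<subseteq> F"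
      using regular_superset_if_porous by auto
  next
    assume "\<exists>t F. 0 < t \<and> t < s \<and> regular_set t F \<and> A \<subseteq> F"
    then show "\<exists>\<rho>>0. uniformly_porous \<rho> A"
      using porous_if_regular_superset by auto
  qed
qed

end
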